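(* Let a group $G$ act faithfully on each of two disjoint sets $S_1$ and $S_2$, and let $f\colon S_1\to S_2$ be a bijection that is $G$-anti-equivariant, i.e. $f(g\cdot s)=g^{-1}\cdot f(s)$ for all $g\in G$ and all $s\in S_1$. Let $\overline{S}:=S_1\sqcup S_2$ and let $\overline{f}:=f\sqcup f^{-1}\colon\overline{S}\to\overline{S}$, i.e. $\overline{f}(s)=f(s)$ for $s\in S_1$ and $\overline{f}(s)=f^{-1}(s)$ for $s\in S_2$. Let every $g\in G$ act on $\overline{S}$ as $g\sqcup g$ (its given action on $S_1$ and its given action on $S_2$); this action is faithful, and $G$ is regarded as a subgroup of $\mathrm{Sym}(\overline{S})$ via it. Let $\overline{G}:=\langle G,\overline{f}\rangle\le\mathrm{Sym}(\overline{S})$. Then: (1) $\overline{f}$ is a $G$-anti-equivariant involution. (2) $G$ is normal in $\overline{G}$, and $\overline{G}$ is the internal semi-direct product $G\rtimes\langle\overline{f}\rangle$. The conjugation of elements of $G$ by $\overline{f}$ is inversion, that is, $\overline{f}g\overline{f}^{-1}=g^{-1}$ for all $g \in G$. Moreover, $\overline{G}$ is the disjoint union $\overline{G}=G\cup\overline{f}G=G\cup G\overline{f}$, where $G$ is exactly the set of those transformations in $\overline{G}$ that preserve $S_1$ and $S_2$, and the coset $\overline{f}G=G\overline{f}$ is exactly the set of those transformations in $\overline{G}$ that exchange $S_1$ and $S_2$. (3) There is a short exact sequence $$\{Id_{\overline{S}}\}\longrightarrow G\longrightarrow\overline{G}\longrightarrow\langle\overline{f}\rangle\longrightarrow\{Id_{\overline{S}}\},$$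 where $G\to\overline{G}$ is the inclusion and $\overline{G}\to\langle\overline{f}\rangle$ is $g\overline{f}^i\mapsto\overline{f}^i$. This short exact sequence is right split, so is isomorphic to the semi-direct product short exact sequence for $G\rtimes\langle\overline{f}\rangle$. (4) If the action of $G$ on $S_1$ is simply transitive, then the action of $G$ on $S_2$ is also simply transitive, and the action of $\overline{G}$ on $\overline{S}$ is also simply transitive. (5) Suppose the action of $G$ on $S_1$ is simply transitive. Suppose $H$ is another group that acts on $S_1$ and $S_2$, and that $k\colon S_1\to S_2$ is an $H$-anti-equivariant bijection. Define $\overline{k}=k\sqcup k^{-1}\colon\overline{S}\to\overline{S}$. Suppose $H$ acts simply transitively on $S_1$ (so that (1)–(4) apply to $H$ and $k$, and in particular $H$ is regarded as a subgroup of $\mathrm{Sym}(\overline{S})$ via its actions on $S_1$ and $S_2$). Suppose moreover that - $k^{-1}f=f^{-1}k$, - the actions of $G$ and $H$ on $S_1$ commute, - $f$ is $H$-equivariant, and - $k$ is $G$-equivariant. Then the actions of $G$ and $H$ on $S_2$ commute, $\overline{f}$ and $\overline{k}$ commute, and $\overline{G}=\langle G,\overline{f}\rangle$ and $\overline{H}:=\langle H,\overline{k}\rangle$ are (Lewin) dual groups in $\mathrm{Sym}(\overline{S})$.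
   Context: All group actions are left actions. An action of $G$ on $S$ is faithful if the induced homomorphism $G\to\mathrm{Sym}(S)$ is injective; it is simply transitive if for all $s,s'\in S$ there is a unique $g\in G$ with $gs=s'$. A map $f$ between $G$-sets is $G$-equivariant if $f(gs)=gf(s)$ for all $g,s$, and $G$-anti-equivariant if $f(gs)=g^{-1}f(s)$ for all $g,s$. Two subgroups $G$ and $H$ of a symmetric group $\mathrm{Sym}(S)$ are dual in the sense of Lewin (Lewin dual, or simply dual) if each acts simply transitively on $S$ and each is the centralizer of the other in $\mathrm{Sym}(S)$. A short exact sequence $1\to A\to B\to C\to 1$ of groups is right split if the homomorphism $B\to C$ has a right inverse homomorphism $C\to B$. A transformation of $\overline{S}=S_1\sqcup S_2$ preserves $S_1$ and $S_2$ if it maps each $S_j$ onto itself, and exchanges them if it maps $S_1$ onto $S_2$ and $S_2$ onto $S_1$. *)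

theory Defs
  imports "HOL-Algebra.Group_Action" "HOL-Algebra.Exact_Sequence"
begin

text \<open>
  The symmetric group of \<open>S\<close> is \<^const>\<open>BijGroup\<close> \<open>S\<close>, whose elements are the bijections of \<open>S\<close>
  that are extensional on \<open>S\<close>; all maps built below are therefore restricted to their domain.
\<close>

locale simply_transitive_action = group_action +
  assumes unique_mover: "\<lbrakk> x \<in> E; y \<in> E \<rbrakk> \<Longrightarrow> \<exists>!g. g \<in> carrier G \<and> (\<phi> g) x = y"

definition equivariant ::
  "('g, 'm) monoid_scheme \<Rightarrow> 'a set \<Rightarrow> ('g \<Rightarrow> 'a \<Rightarrow> 'a) \<Rightarrow> ('g \<Rightarrow> 'b \<Rightarrow> 'b) \<Rightarrow> ('a \<Rightarrow> 'b) \<Rightarrow> bool"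
  where "equivariant G S \<phi> \<psi> f \<longleftrightarrow> (\<forall>g\<in>carrier G. \<forall>s\<in>S. f (\<phi> g s) = \<psi> g (f s))"

definition anti_equivariant ::
  "('g, 'm) monoid_scheme \<Rightarrow> 'a set \<Rightarrow> ('g \<Rightarrow> 'a \<Rightarrow> 'a) \<Rightarrow> ('g \<Rightarrow> 'b \<Rightarrow> 'b) \<Rightarrow> ('a \<Rightarrow> 'b) \<Rightarrow> bool"
  where "anti_equivariant G S \<phi> \<psi> f \<longleftrightarrow>
    (\<forall>g\<in>carrier G. \<forall>s\<in>S. f (\<phi> g s) = \<psi> (inv\<^bsub>G\<^esub> g) (f s))"

definition actions_commute ::
  "('g, 'm) monoid_scheme \<Rightarrow> ('h, 'n) monoid_scheme \<Rightarrow> 'a set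
    \<Rightarrow> ('g \<Rightarrow> 'a \<Rightarrow> 'a) \<Rightarrow> ('h \<Rightarrow> 'a \<Rightarrow> 'a) \<Rightarrow> bool"
  where "actions_commute G H S \<phi> \<psi> \<longleftrightarrow>
    (\<forall>g\<in>carrier G. \<forall>h\<in>carrier H. \<forall>s\<in>S. \<phi> g (\<psi> h s) = \<psi> h (\<phi> g s))"

text \<open>The map \<open>a \<squnion> b\<close> on the union of the disjoint sets \<open>S1\<close> and \<open>S2\<close>.\<close>

definition glue :: "'a set \<Rightarrow> 'a set \<Rightarrow> ('a \<Rightarrow> 'b) \<Rightarrow> ('a \<Rightarrow> 'b) \<Rightarrow> 'a \<Rightarrow> 'b"
  where "glue S1 S2 a b = (\<lambda>s\<in>S1 \<union> S2. if s \<in> S1 then a s else b s)"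

definition bar_map :: "'a set \<Rightarrow> 'a set \<Rightarrow> ('a \<Rightarrow> 'a) \<Rightarrow> 'a \<Rightarrow> 'a"
  where "bar_map S1 S2 f = glue S1 S2 f (inv_into S1 f)"

definition sum_action ::
  "'a set \<Rightarrow> 'a set \<Rightarrow> ('g \<Rightarrow> 'a \<Rightarrow> 'a) \<Rightarrow> ('g \<Rightarrow> 'a \<Rightarrow> 'a) \<Rightarrow> 'g \<Rightarrow> 'a \<Rightarrow> 'a"
  where "sum_action S1 S2 \<phi>1 \<phi>2 g = glue S1 S2 (\<phi>1 g) (\<phi>2 g)"

definition centralizer :: "('a, 'm) monoid_scheme \<Rightarrow> 'a set \<Rightarrow> 'a set"
  where "centralizer K A = {z \<in> carrier K. \<forall>x\<in>A. z \<otimes>\<^bsub>K\<^esub> x = x \<otimes>\<^bsub>K\<^esub> z}"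

definition lewin_dual :: "'a set \<Rightarrow> ('a \<Rightarrow> 'a) set \<Rightarrow> ('a \<Rightarrow> 'a) set \<Rightarrow> bool"
  where "lewin_dual S P Q \<longleftrightarrow>
    subgroup P (BijGroup S) \<and> subgroup Q (BijGroup S) \<and>
    simply_transitive_action ((BijGroup S)\<lparr>carrier := P\<rparr>) S (\<lambda>t. t) \<and>
    simply_transitive_action ((BijGroup S)\<lparr>carrier := Q\<rparr>) S (\<lambda>t. t) \<and>
    P = centralizer (BijGroup S) Q \<and> Q = centralizer (BijGroup S) P"

definition internal_semidirect :: "('a, 'm) monoid_scheme \<Rightarrow> 'a set \<Rightarrow> 'a set \<Rightarrow> bool"
  where "internal_semidirect K N Q \<longleftrightarrow>
    N \<lhd> K \<and> subgroup Q K \<and> N <#>\<^bsub>K\<^esub> Q = carrier K \<and> N \<inter> Q = {\<one>\<^bsub>K\<^esub>}"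

definition semidirect_product ::
  "('a, 'm) monoid_scheme \<Rightarrow> ('b, 'n) monoid_scheme \<Rightarrow> ('b \<Rightarrow> 'a \<Rightarrow> 'a) \<Rightarrow> ('a \<times> 'b) monoid"
  where "semidirect_product N Q \<theta> =
    \<lparr>carrier = carrier N \<times> carrier Q,
     monoid.mult = (\<lambda>(n, q) (n', q'). (n \<otimes>\<^bsub>N\<^esub> \<theta> q n', q \<otimes>\<^bsub>Q\<^esub> q')),
     one = (\<one>\<^bsub>N\<^esub>, \<one>\<^bsub>Q\<^esub>)\<rparr>"

definition right_split ::
  "('b, 'm) monoid_scheme \<Rightarrow> ('c, 'n) monoid_scheme \<Rightarrow> ('b \<Rightarrow> 'c) \<Rightarrow> bool"
  where "right_split B C p \<longleftrightarrow> (\<exists>\<sigma>\<in>hom C B. \<forall>c\<in>carrier C. p (\<sigma> c) = c)"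

text \<open>
  Isomorphism of the sequences \<open>A \<rightarrow> B \<rightarrow> C\<close> (maps \<open>i\<close>, \<open>p\<close>) and \<open>A' \<rightarrow> B' \<rightarrow> C'\<close> (maps \<open>i'\<close>, \<open>p'\<close>):
  three isomorphisms making both squares commute.
\<close>

definition sequences_isomorphic ::
  "('a, 'k) monoid_scheme \<Rightarrow> ('b, 'l) monoid_scheme \<Rightarrow> ('c, 'm) monoid_scheme
    \<Rightarrow> ('a \<Rightarrow> 'b) \<Rightarrow> ('b \<Rightarrow> 'c)
    \<Rightarrow> ('d, 'n) monoid_scheme \<Rightarrow> ('e, 'o) monoid_scheme \<Rightarrow> ('f, 'p) monoid_scheme
    \<Rightarrow> ('d \<Rightarrow> 'e) \<Rightarrow> ('e \<Rightarrow> 'f) \<Rightarrow> bool"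
  where "sequences_isomorphic A B C i p A' B' C' i' p' \<longleftrightarrow>
    (\<exists>\<alpha>\<in>iso A A'. \<exists>\<beta>\<in>iso B B'. \<exists>\<gamma>\<in>iso C C'.
      (\<forall>a\<in>carrier A. \<beta> (i a) = i' (\<alpha> a)) \<and> (\<forall>b\<in>carrier B. \<gamma> (p b) = p' (\<beta> b)))"

end

theory Submission
  imports Defs
begin

text \<open>
  Let \<open>fbar\<close> denote the involution of \<open>S1 \<squnion> S2\<close> made from \<open>f\<close> and its inverse. Anti-equivariance
  of \<open>f\<close> carries over to \<open>fbar\<close>, and it says precisely that conjugation by \<open>fbar\<close> inverts each
  element of \<open>G\<close> (\<open>conjugation_inverts\<close>). Hence \<open>fbar\<close> normalizes \<open>G\<close>, and the group generated by
  \<open>G\<close> and \<open>fbar\<close> is just \<open>G \<union> fbar G\<close>, a fact about any involution that normalizes a subgroup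
  (locale \<open>normalizing_involution\<close>). Elements of \<open>G\<close> preserve the two pieces and elements of
  \<open>fbar G\<close> exchange them, which separates the two cosets, makes \<open>G \<inter> \<langle>fbar\<rangle>\<close> trivial, and so gives
  the semidirect product. The split exact sequence is a formal consequence valid for every internal
  semidirect product (\<open>internal_semidirect_split\<close>).

  If \<open>G\<close> is simply transitive on \<open>S1\<close>, it is so on \<open>S2\<close> by transport along \<open>f\<close>. The extended
  group then joins points in one piece by \<open>G\<close> and points in different pieces by \<open>fbar G\<close>; it acts
  freely because an element of \<open>fbar G\<close> exchanges disjoint sets and so has no fixed point
  (\<open>simply_transitive_extension\<close>).

  For the duality, the hypotheses on \<open>f\<close> and \<open>k\<close> make each generator of one extended group commute
  with each generator of the other (\<open>extensions_commute\<close>). Two commuting transitive groups are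
  each other's centralizers: a transformation that commutes with a transitive group is determined by
  its value at one point, and the other group already realizes every value
  (\<open>centralizer_of_transitive\<close>).
\<close>

section \<open>Extending a subgroup by an involution that normalizes it\<close>

text \<open>
  If an involution \<open>x\<close> normalizes \<open>N\<close>, then \<open>N \<union> x N\<close> is already closed under products: in a
  product of two elements the factors \<open>x\<close> can be moved past elements of \<open>N\<close>, where they cancel.
  Normalization is stated as \<open>x n x \<in> N\<close>, which is conjugation because \<open>x\<close> is its own inverse.
\<close>

locale normalizing_involution = group +
  fixes N x
  assumes N: "subgroup N G"
    and x: "x \<in> carrier G"
    and invol: "x \<otimes> x = \<one>"
    and normalizes: "n \<in> N \<Longrightarrow> x \<otimes> n \<otimes> x \<in> N"
begin

lemma N_carrier: "n \<in> N \<Longrightarrow> n \<in> carrier G"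
  using N subgroup.mem_carrier by fast

lemma inv_x: "inv x = x"
  using inv_equality invol x by blast

lemma x_cancel: "a \<in> carrier G \<Longrightarrow> x \<otimes> (x \<otimes> a) = a"
  using x invol by (simp flip: m_assoc)

lemma generate_x: "generate G {x} = {\<one>, x}"
proof -
  have "subgroup {\<one>, x} G"
    by (rule subgroupI) (use x invol inv_x in auto)
  then have "generate G {x} \<subseteq> {\<one>, x}"
    by (intro generate_subgroup_incl) auto
  then show ?thesis
    by (auto intro: generate.one generate.incl)
qed

lemma x_pow: "x [^] (i::int) \<in> {\<one>, x}"
proof -
  have "subgroup (generate G {x}) G"
    using generate_is_subgroup x by simp
  then show ?thesis
    using subgroup_int_pow_closed generate_x by blast
qed

lemma commute_past_x:
  assumes "n \<in> N"
  obtains m where "m \<in> N" "x \<otimes> n = m \<otimes> x" "n \<otimes> x = x \<otimes> m"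
proof
  show "x \<otimes> n \<otimes> x \<in> N" by (rule normalizes[OF assms])
  show "x \<otimes> n = x \<otimes> n \<otimes> x \<otimes> x" "n \<otimes> x = x \<otimes> (x \<otimes> n \<otimes> x)"
    using N_carrier[OF assms] x invol by (simp_all add: m_assoc x_cancel)
qed

lemma l_coset_x_eq: "x <# N = N #> x"
proof (intro equalityI subsetI)
  fix a assume "a \<in> x <# N"
  then obtain n where "n \<in> N" "a = x \<otimes> n" by (auto simp: l_coset_def)
  then obtain m where "m \<in> N" "a = m \<otimes> x" using commute_past_x by metis
  then show "a \<in> N #> x" by (auto simp: r_coset_def)
next
  fix a assume "a \<in> N #> x"
  then obtain n where "n \<in> N" "a = n \<otimes> x" by (auto simp: r_coset_def)
  then obtain m where "m \<in> N" "a = x \<otimes> m" using commute_past_x by metis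
  then show "a \<in> x <# N" by (auto simp: l_coset_def)
qed

lemma x_in_l_coset: "x \<in> x <# N"
proof -
  have "x = x \<otimes> \<one>" using x by simp
  then show ?thesis
    unfolding l_coset_def using subgroup.one_closed[OF N] by blast
qed

lemma subgroup_union: "subgroup (N \<union> (x <# N)) G"
proof (rule subgroupI)
  show "N \<union> (x <# N) \<subseteq> carrier G"
    using N_carrier x by (auto simp: l_coset_def)
  show "N \<union> (x <# N) \<noteq> {}"
    using subgroup.one_closed[OF N] by auto
next
  fix a assume "a \<in> N \<union> (x <# N)"
  then consider "a \<in> N" | n where "n \<in> N" "a = x \<otimes> n"
    by (auto simp: l_coset_def)
  then show "inv a \<in> N \<union> (x <# N)"
  proof cases
    case 1
    then show ?thesis by (simp add: subgroup.m_inv_closed[OF N])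
  next
    case 2
    then have "inv n \<in> N" by (simp add: subgroup.m_inv_closed[OF N])
    moreover have "inv a = inv n \<otimes> x"
      using 2 N_carrier x inv_x by (simp add: inv_mult_group)
    ultimately have "inv a \<in> N #> x" by (auto simp: r_coset_def)
    then show ?thesis using l_coset_x_eq by simp
  qed
next
  fix a b assume a: "a \<in> N \<union> (x <# N)" and b: "b \<in> N \<union> (x <# N)"
  have closed: "\<And>m n. m \<in> N \<Longrightarrow> n \<in> N \<Longrightarrow> m \<otimes> n \<in> N"
    using subgroup.m_closed[OF N] .
  \<comment> \<open>Writing one factor as \<open>m x\<close> and the other as \<open>x n\<close> brings the two copies of \<open>x\<close> together.\<close>
  have a': "a \<in> N \<or> (\<exists>m\<in>N. a = x \<otimes> m)" "a \<in> N \<or> (\<exists>m\<in>N. a = m \<otimes> x)"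
    using a l_coset_x_eq by (auto simp: l_coset_def r_coset_def)
  have b': "b \<in> N \<or> (\<exists>n\<in>N. b = x \<otimes> n)" "b \<in> N \<or> (\<exists>n\<in>N. b = n \<otimes> x)"
    using b l_coset_x_eq by (auto simp: l_coset_def r_coset_def)
  consider "a \<in> N" "b \<in> N" | n where "a \<in> N" "n \<in> N" "b = n \<otimes> x"
    | m where "m \<in> N" "a = x \<otimes> m" "b \<in> N" | m n where "m \<in> N" "n \<in> N" "a = m \<otimes> x" "b = x \<otimes> n"
    using a' b' by (cases "a \<in> N"; cases "b \<in> N") blast+
  then show "a \<otimes> b \<in> N \<union> (x <# N)"
  proof cases
    case 1 then show ?thesis by (simp add: closed)
  next
    case 2
    then have "a \<otimes> b = (a \<otimes> n) \<otimes> x" using N_carrier x by (simp add: m_assoc)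
    then have "a \<otimes> b \<in> N #> x" using 2 closed by (auto simp: r_coset_def)
    then show ?thesis using l_coset_x_eq by simp
  next
    case 3
    then have "a \<otimes> b = x \<otimes> (m \<otimes> b)" using N_carrier x by (simp add: m_assoc)
    then show ?thesis using 3 closed by (auto simp: l_coset_def)
  next
    case 4
    then have "a \<otimes> b = m \<otimes> n" using N_carrier x by (simp add: m_assoc x_cancel)
    then show ?thesis using 4 closed by simp
  qed
qed

lemma generate_union: "generate G (N \<union> {x}) = N \<union> (x <# N)"
proof
  show "generate G (N \<union> {x}) \<subseteq> N \<union> (x <# N)"
  proof (rule generate_subgroup_incl[OF _ subgroup_union])
    show "N \<union> {x} \<subseteq> N \<union> (x <# N)" using x_in_l_coset by blast
  qed
  show "N \<union> (x <# N) \<subseteq> generate G (N \<union> {x})"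
  proof
    fix b assume "b \<in> N \<union> (x <# N)"
    then consider "b \<in> N" | n where "n \<in> N" "b = x \<otimes> n"
      by (auto simp: l_coset_def)
    then show "b \<in> generate G (N \<union> {x})"
      by cases (simp_all add: generate.incl generate.eng)
  qed
qed

lemma normal_union: "N \<lhd> G\<lparr>carrier := N \<union> (x <# N)\<rparr>"
proof -
  let ?B = "N \<union> (x <# N)"
  interpret B: group "G\<lparr>carrier := ?B\<rparr>"
    by (rule subgroup_imp_group[OF subgroup_union])
  show ?thesis
  proof (rule B.normal_invI)
    show "subgroup N (G\<lparr>carrier := ?B\<rparr>)"
      by (rule subgroup_incl[OF N subgroup_union]) simp
  next
    fix b n assume b: "b \<in> carrier (G\<lparr>carrier := ?B\<rparr>)" and n: "n \<in> N"
    have inN: "m \<otimes> n \<otimes> inv m \<in> N" if "m \<in> N" for m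
      using that n by (simp add: subgroup.m_closed[OF N] subgroup.m_inv_closed[OF N])
    have "b \<otimes> n \<otimes> inv b \<in> N"
    proof (cases "b \<in> N")
      case False
      then obtain m where m: "m \<in> N" and b': "b = x \<otimes> m"
        using b by (auto simp: l_coset_def)
      have "b \<otimes> n \<otimes> inv b = x \<otimes> (m \<otimes> n \<otimes> inv m) \<otimes> x"
        using m n b' N_carrier x inv_x by (simp add: inv_mult_group m_assoc)
      then show ?thesis using normalizes[OF inN[OF m]] by simp
    qed (rule inN)
    then show "b \<otimes>\<^bsub>G\<lparr>carrier := ?B\<rparr>\<^esub> n \<otimes>\<^bsub>G\<lparr>carrier := ?B\<rparr>\<^esub> inv\<^bsub>G\<lparr>carrier := ?B\<rparr>\<^esub> b \<in> N"
      using b m_inv_consistent[OF subgroup_union] by simp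
  qed
qed

text \<open>
  Since \<open>\<langle>x\<rangle> = {1, x}\<close>, a trivial intersection with \<open>N\<close> amounts to saying that \<open>x \<in> N\<close> only
  if \<open>x = 1\<close>. In this form the degenerate case of a trivial \<open>x\<close> is covered.
\<close>

lemma internal_semidirect_union:
  assumes "x \<in> N \<Longrightarrow> x = \<one>"
  shows "internal_semidirect (G\<lparr>carrier := N \<union> (x <# N)\<rparr>) N {\<one>, x}"
  unfolding internal_semidirect_def
proof (intro conjI)
  have one: "\<one> \<in> N" by (rule subgroup.one_closed[OF N])
  have sub: "subgroup {\<one>, x} G"
    using generate_is_subgroup[of "{x}"] x generate_x by simp
  show "N \<lhd> G\<lparr>carrier := N \<union> (x <# N)\<rparr>" by (rule normal_union)
  show "subgroup {\<one>, x} (G\<lparr>carrier := N \<union> (x <# N)\<rparr>)"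
  proof (rule subgroup_incl[OF sub subgroup_union])
    show "{\<one>, x} \<subseteq> N \<union> (x <# N)" using one x_in_l_coset by simp
  qed
  have "N <#> {\<one>, x} = (\<Union>n\<in>N. {n \<otimes> \<one>}) \<union> (\<Union>n\<in>N. {n \<otimes> x})"
    unfolding set_mult_def by blast
  then have "N <#> {\<one>, x} = N \<union> (N #> x)"
    using N_carrier by (simp add: r_coset_def)
  then show "N <#>\<^bsub>G\<lparr>carrier := N \<union> (x <# N)\<rparr>\<^esub> {\<one>, x} = carrier (G\<lparr>carrier := N \<union> (x <# N)\<rparr>)"
    using l_coset_x_eq by (simp add: set_mult_def)
  show "N \<inter> {\<one>, x} = {\<one>\<^bsub>G\<lparr>carrier := N \<union> (x <# N)\<rparr>\<^esub>}"
    using assms one by auto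
qed

end

section \<open>The split sequence of an internal semidirect product\<close>

lemma exact_seq_short_five:
  assumes K: "group K" and A: "subgroup A K" and B: "subgroup B K" and Q: "subgroup Q K"
    and AB: "A \<subseteq> B"
    and p: "p \<in> hom (K\<lparr>carrier := B\<rparr>) (K\<lparr>carrier := Q\<rparr>)"
    and ker: "{b \<in> B. p b = \<one>\<^bsub>K\<^esub>} = A"
    and surj: "p ` B = Q"
  shows "exact_seq
    ([K\<lparr>carrier := {\<one>\<^bsub>K\<^esub>}\<rparr>, K\<lparr>carrier := Q\<rparr>, K\<lparr>carrier := B\<rparr>, K\<lparr>carrier := A\<rparr>,
      K\<lparr>carrier := {\<one>\<^bsub>K\<^esub>}\<rparr>], [\<lambda>t. \<one>\<^bsub>K\<^esub>, p, \<lambda>t. t, \<lambda>t. t])"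
proof -
  interpret K: group K by (rule K)
  let ?r = "\<lambda>X. K\<lparr>carrier := X\<rparr>"
  have grp: "group (?r {\<one>\<^bsub>K\<^esub>})" "group (?r A)" "group (?r B)" "group (?r Q)"
    by (rule K.subgroup_imp_group; fact A B Q K.triv_subgroup)+
  have one: "\<one>\<^bsub>K\<^esub> \<in> A" by (rule subgroup.one_closed[OF A])
  have "group_hom (?r {\<one>\<^bsub>K\<^esub>}) (?r A) (\<lambda>t. t)"
    unfolding group_hom_def group_hom_axioms_def using grp one by (simp add: hom_def)
  moreover have "(\<lambda>t. t) \<in> hom (?r A) (?r B)" "(\<lambda>t. \<one>\<^bsub>K\<^esub>) \<in> hom (?r Q) (?r {\<one>\<^bsub>K\<^esub>})"
    using AB by (auto simp: hom_def)
  moreover have "kernel (?r A) (?r B) (\<lambda>t. t) = (\<lambda>t. t) ` carrier (?r {\<one>\<^bsub>K\<^esub>})"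
    using one by (auto simp: kernel_def)
  moreover have "kernel (?r B) (?r Q) p = (\<lambda>t. t) ` carrier (?r A)"
    using ker by (simp add: kernel_def)
  moreover have "kernel (?r Q) (?r {\<one>\<^bsub>K\<^esub>}) (\<lambda>t. \<one>\<^bsub>K\<^esub>) = p ` carrier (?r B)"
    using surj by (simp add: kernel_def)
  ultimately show ?thesis
    using grp p by (intro exact_seq.extension exact_seq.unity)
qed

text \<open>
  Every element of \<open>N Q\<close> is a product \<open>n q\<close> for exactly one \<open>n \<in> N\<close> and one \<open>q \<in> Q\<close>, because
  \<open>N \<inter> Q\<close> is trivial. Both components are therefore functions of the element. The second one is the
  projection \<open>p\<close>, split by the inclusion of \<open>Q\<close>; the two together form the isomorphism with the
  semidirect product.
\<close>

lemma internal_semidirect_split: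
  fixes G :: "'a monoid" (structure)
  assumes G: "group G" and B: "subgroup B G" and semi: "internal_semidirect (G\<lparr>carrier := B\<rparr>) N Q"
  obtains p where
    "\<And>n q. \<lbrakk>n \<in> N; q \<in> Q\<rbrakk> \<Longrightarrow> p (n \<otimes> q) = q"
    "exact_seq
      ([G\<lparr>carrier := {\<one>}\<rparr>, G\<lparr>carrier := Q\<rparr>, G\<lparr>carrier := B\<rparr>, G\<lparr>carrier := N\<rparr>,
        G\<lparr>carrier := {\<one>}\<rparr>], [\<lambda>t. \<one>, p, \<lambda>t. t, \<lambda>t. t])"
    "right_split (G\<lparr>carrier := B\<rparr>) (G\<lparr>carrier := Q\<rparr>) p"
    "sequences_isomorphic
       (G\<lparr>carrier := N\<rparr>) (G\<lparr>carrier := B\<rparr>) (G\<lparr>carrier := Q\<rparr>) (\<lambda>t. t) p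
       (G\<lparr>carrier := N\<rparr>)
       (semidirect_product (G\<lparr>carrier := N\<rparr>) (G\<lparr>carrier := Q\<rparr>) (\<lambda>q n. q \<otimes> n \<otimes> inv q))
       (G\<lparr>carrier := Q\<rparr>) (\<lambda>n. (n, \<one>)) snd"
proof -
  interpret group G by (rule G)
  interpret B: group "G\<lparr>carrier := B\<rparr>" by (rule subgroup_imp_group[OF B])
  have N': "N \<lhd> G\<lparr>carrier := B\<rparr>" and Q': "subgroup Q (G\<lparr>carrier := B\<rparr>)"
    and prod: "N <#> Q = B" and triv: "N \<inter> Q = {\<one>}"
    using semi by (auto simp: internal_semidirect_def set_mult_def)
  have N: "subgroup N G" and Q: "subgroup Q G"
    using N' Q' B incl_subgroup normal_imp_subgroup by blast+
  have NB: "N \<subseteq> B" and QB: "Q \<subseteq> B"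
    using subgroup.subset[OF Q'] subgroup.subset[OF normal_imp_subgroup[OF N']] by auto
  have Nc: "\<And>n. n \<in> N \<Longrightarrow> n \<in> carrier G" and Qc: "\<And>q. q \<in> Q \<Longrightarrow> q \<in> carrier G"
    using subgroup.subset[OF N] subgroup.subset[OF Q] by auto
  note [simp] = subgroup.one_closed[OF N] subgroup.one_closed[OF Q]
    subgroup.m_closed[OF N] subgroup.m_closed[OF Q]
    subgroup.m_inv_closed[OF N] subgroup.m_inv_closed[OF Q] Nc Qc
  have conj [simp]: "q \<otimes> n \<otimes> inv q \<in> N" if "q \<in> Q" "n \<in> N" for q n
    using B.normal_invE(2)[OF N', of q n] that QB m_inv_consistent[OF B, of q] by auto
  have prodE: "\<exists>n\<in>N. \<exists>q\<in>Q. b = n \<otimes> q" if "b \<in> B" for b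
    using that prod by (auto simp: set_mult_def)
  have prodI: "n \<otimes> q \<in> B" if "n \<in> N" "q \<in> Q" for n q
    using that prod by (auto simp: set_mult_def)
  have uniq: "n = n' \<and> q = q'"
    if "n \<in> N" "n' \<in> N" "q \<in> Q" "q' \<in> Q" and eq: "n \<otimes> q = n' \<otimes> q'" for n n' q q'
  proof -
    have "inv n' \<otimes> n = q' \<otimes> inv q"
      using that by (metis Nc Qc inv_closed inv_solve_left inv_solve_right m_assoc m_closed)
    moreover have "inv n' \<otimes> n \<in> N" "q' \<otimes> inv q \<in> Q" using that by auto
    ultimately have "q' \<otimes> inv q = \<one>" using triv by auto
    then have "q = q'" using that by (metis Qc inv_equality inv_inv inv_closed)
    then show ?thesis using that by auto
  qed
  define p where "p b = (THE q. q \<in> Q \<and> (\<exists>n\<in>N. b = n \<otimes> q))" for b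
  define \<nu> where "\<nu> b = (THE n. n \<in> N \<and> (\<exists>q\<in>Q. b = n \<otimes> q))" for b
  have p: "p (n \<otimes> q) = q" and \<nu>: "\<nu> (n \<otimes> q) = n" if "n \<in> N" "q \<in> Q" for n q
    unfolding p_def \<nu>_def using that uniq by (intro the_equality; blast)+
  have p1: "p q = q" if "q \<in> Q" for q
    using p[of \<one> q] that by simp
  have pN: "p n = \<one>" and \<nu>N: "\<nu> n = n" if "n \<in> N" for n
    using p[of n \<one>] \<nu>[of n \<one>] that by simp_all
  \<comment> \<open>The multiplication rule of the semidirect product, read off inside the group.\<close>
  have mult: "(n \<otimes> q) \<otimes> (n' \<otimes> q') = (n \<otimes> (q \<otimes> n' \<otimes> inv q)) \<otimes> (q \<otimes> q')"
    if "n \<in> N" "n' \<in> N" "q \<in> Q" "q' \<in> Q" for n n' q q'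
  proof -
    have "inv q \<otimes> (q \<otimes> q') = q'" using that by (simp flip: m_assoc)
    then show ?thesis using that by (simp add: m_assoc)
  qed
  have p_mult: "p (b \<otimes> b') = p b \<otimes> p b'" 
    and \<nu>_mult: "\<nu> (b \<otimes> b') = \<nu> b \<otimes> (p b \<otimes> \<nu> b' \<otimes> inv (p b))"
    if b: "b \<in> B" and b': "b' \<in> B" for b b'
  proof -
    obtain n q where nq: "n \<in> N" "q \<in> Q" "b = n \<otimes> q" using prodE[OF b] by blast
    obtain n' q' where nq': "n' \<in> N" "q' \<in> Q" "b' = n' \<otimes> q'" using prodE[OF b'] by blast
    have "n \<otimes> (q \<otimes> n' \<otimes> inv q) \<in> N" "q \<otimes> q' \<in> Q" using nq nq' by simp_all
    then show "p (b \<otimes> b') = p b \<otimes> p b'" 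
      "\<nu> (b \<otimes> b') = \<nu> b \<otimes> (p b \<otimes> \<nu> b' \<otimes> inv (p b))"
      using nq nq' by (simp_all only: mult p \<nu>)
  qed
  have pQ: "p b \<in> Q" and \<nu>B: "\<nu> b \<in> N" and dec: "\<nu> b \<otimes> p b = b" if "b \<in> B" for b
    using prodE[OF that] p \<nu> by auto
  have phom: "p \<in> hom (G\<lparr>carrier := B\<rparr>) (G\<lparr>carrier := Q\<rparr>)"
    by (rule homI) (simp_all add: pQ p_mult)
  have ker: "{b \<in> B. p b = \<one>} = N"
  proof (intro equalityI subsetI)
    fix b assume b: "b \<in> {b \<in> B. p b = \<one>}"
    then have "b = \<nu> b" using dec[of b] \<nu>B[of b] by simp
    then show "b \<in> N" using \<nu>B[of b] b by simp
  qed (use NB pN in auto)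
  have surj: "p ` B = Q"
    using pQ p1 QB by force
  have "right_split (G\<lparr>carrier := B\<rparr>) (G\<lparr>carrier := Q\<rparr>) p"
    unfolding right_split_def
    by (rule bexI[where x = "\<lambda>q. q"]) (use QB p1 in \<open>auto simp: hom_def\<close>)
  moreover have "sequences_isomorphic
       (G\<lparr>carrier := N\<rparr>) (G\<lparr>carrier := B\<rparr>) (G\<lparr>carrier := Q\<rparr>) (\<lambda>t. t) p
       (G\<lparr>carrier := N\<rparr>)
       (semidirect_product (G\<lparr>carrier := N\<rparr>) (G\<lparr>carrier := Q\<rparr>) (\<lambda>q n. q \<otimes> n \<otimes> inv q))
       (G\<lparr>carrier := Q\<rparr>) (\<lambda>n. (n, \<one>)) snd"
    unfolding sequences_isomorphic_def
  proof (intro bexI conjI ballI)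
    show "(\<lambda>n. n) \<in> iso (G\<lparr>carrier := N\<rparr>) (G\<lparr>carrier := N\<rparr>)"
      "(\<lambda>q. q) \<in> iso (G\<lparr>carrier := Q\<rparr>) (G\<lparr>carrier := Q\<rparr>)"
      by (auto simp: iso_def hom_def bij_betw_def)
    have "bij_betw (\<lambda>b. (\<nu> b, p b)) B (N \<times> Q)"
      by (rule bij_betw_byWitness[where f' = "\<lambda>(n, q). n \<otimes> q"])
        (auto simp: p \<nu> pQ \<nu>B dec prodI)
    then show "(\<lambda>b. (\<nu> b, p b)) \<in> iso (G\<lparr>carrier := B\<rparr>)
      (semidirect_product (G\<lparr>carrier := N\<rparr>) (G\<lparr>carrier := Q\<rparr>) (\<lambda>q n. q \<otimes> n \<otimes> inv q))"
      by (auto simp: iso_def hom_def semidirect_product_def p_mult \<nu>_mult pQ \<nu>B)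
  next
    fix n assume "n \<in> carrier (G\<lparr>carrier := N\<rparr>)"
    then show "(\<nu> n, p n) = (n, \<one>)" by (simp add: pN \<nu>N)
  qed simp
  ultimately show thesis
    using that[OF p] exact_seq_short_five[OF group_axioms N B Q NB phom ker surj] by blast
qed

section \<open>Transformations of a set\<close>

lemma BijGroup_mult_apply:
  assumes "t \<in> carrier (BijGroup S)" "u \<in> carrier (BijGroup S)" "x \<in> S"
  shows "(t \<otimes>\<^bsub>BijGroup S\<^esub> u) x = t (u x)"
  using assms by (simp add: BijGroup_def compose_eq)

lemma BijGroup_one_apply: "x \<in> S \<Longrightarrow> \<one>\<^bsub>BijGroup S\<^esub> x = x"
  by (simp add: BijGroup_def)

lemma BijGroup_eqI:
  assumes "t \<in> carrier (BijGroup S)" "u \<in> carrier (BijGroup S)" "\<And>x. x \<in> S \<Longrightarrow> t x = u x"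
  shows "t = u"
  using assms by (auto simp: BijGroup_def Bij_def intro: extensionalityI)

lemma BijGroup_closed: "t \<in> carrier (BijGroup S) \<Longrightarrow> x \<in> S \<Longrightarrow> t x \<in> S"
  using Bij_imp_funcset by (fastforce simp: BijGroup_def)

lemma BijGroup_inv_apply:
  assumes "t \<in> carrier (BijGroup S)" "x \<in> S"
  shows "(inv\<^bsub>BijGroup S\<^esub> t) (t x) = x"
proof -
  interpret group "BijGroup S" by (rule group_BijGroup)
  show ?thesis
    using BijGroup_mult_apply[of "inv\<^bsub>BijGroup S\<^esub> t" S t x] assms by (simp add: BijGroup_one_apply)
qed

lemma subgroup_group_action:
  assumes "subgroup P (BijGroup S)"
  shows "group_action ((BijGroup S)\<lparr>carrier := P\<rparr>) S (\<lambda>t. t)"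
proof -
  interpret group "BijGroup S" by (rule group_BijGroup)
  show ?thesis
    using subgroup_imp_group[OF assms] subgroup.subset[OF assms] group_axioms
    by (auto simp: group_action_def group_hom_def group_hom_axioms_def hom_def)
qed

text \<open>
  If \<open>t\<close> and \<open>u\<close> agree at a point, then \<open>u\<^bsup>-1\<^esup> t\<close> fixes it. So uniqueness only has to be checked
  against the identity.
\<close>

lemma simply_transitive_subgroupI:
  assumes P: "subgroup P (BijGroup S)"
    and trans: "\<And>x y. \<lbrakk>x \<in> S; y \<in> S\<rbrakk> \<Longrightarrow> \<exists>t\<in>P. t x = y"
    and free: "\<And>t x. \<lbrakk>t \<in> P; x \<in> S; t x = x\<rbrakk> \<Longrightarrow> t = \<one>\<^bsub>BijGroup S\<^esub>"
  shows "simply_transitive_action ((BijGroup S)\<lparr>carrier := P\<rparr>) S (\<lambda>t. t)"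
proof -
  interpret group "BijGroup S" by (rule group_BijGroup)
  have "t = u" if t: "t \<in> P" and u: "u \<in> P" and x: "x \<in> S" and eq: "t x = u x" for t u x
  proof -
    have c: "t \<in> carrier (BijGroup S)" "u \<in> carrier (BijGroup S)"
      using t u subgroup.subset[OF P] by auto
    have "inv\<^bsub>BijGroup S\<^esub> u \<otimes>\<^bsub>BijGroup S\<^esub> t \<in> P"
      using t u by (simp add: subgroup.m_closed[OF P] subgroup.m_inv_closed[OF P])
    moreover have "(inv\<^bsub>BijGroup S\<^esub> u \<otimes>\<^bsub>BijGroup S\<^esub> t) x = x"
      using c x eq by (simp add: BijGroup_mult_apply BijGroup_inv_apply)
    ultimately have "inv\<^bsub>BijGroup S\<^esub> u \<otimes>\<^bsub>BijGroup S\<^esub> t = \<one>\<^bsub>BijGroup S\<^esub>"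
      using free x by blast
    then show ?thesis
      using c by (metis inv_closed inv_equality inv_inv)
  qed
  then show ?thesis
    unfolding simply_transitive_action_def simply_transitive_action_axioms_def
    using subgroup_group_action[OF P] trans by (simp, blast)
qed

text \<open>
  A map that commutes with a transitive set \<open>P\<close> is determined by its value at one point. If a
  transitive set \<open>Q\<close> commutes with \<open>P\<close>, it contains a map with any prescribed value at that point,
  so nothing outside \<open>Q\<close> commutes with \<open>P\<close>. Over the empty set there is only one
  transformation, and it lies in \<open>Q\<close> because \<open>Q\<close> is nonempty.
\<close>

lemma centralizer_of_transitive:
  assumes P: "P \<subseteq> carrier (BijGroup S)" and Q: "Q \<subseteq> carrier (BijGroup S)"
    and transP: "\<And>x y. \<lbrakk>x \<in> S; y \<in> S\<rbrakk> \<Longrightarrow> \<exists>t\<in>P. t x = y"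
    and transQ: "\<And>x y. \<lbrakk>x \<in> S; y \<in> S\<rbrakk> \<Longrightarrow> \<exists>t\<in>Q. t x = y"
    and comm: "\<And>t u. \<lbrakk>t \<in> P; u \<in> Q\<rbrakk> \<Longrightarrow> t \<otimes>\<^bsub>BijGroup S\<^esub> u = u \<otimes>\<^bsub>BijGroup S\<^esub> t"
    and ne: "Q \<noteq> {}"
  shows "centralizer (BijGroup S) P = Q"
proof (intro equalityI subsetI)
  fix z assume "z \<in> centralizer (BijGroup S) P"
  then have z: "z \<in> carrier (BijGroup S)"
    and zP: "\<And>t. t \<in> P \<Longrightarrow> z \<otimes>\<^bsub>BijGroup S\<^esub> t = t \<otimes>\<^bsub>BijGroup S\<^esub> z"
    by (auto simp: centralizer_def)
  show "z \<in> Q"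
  proof (cases "S = {}")
    case True
    from ne obtain u where "u \<in> Q" by auto
    moreover have "z = u" using True z \<open>u \<in> Q\<close> Q by (intro BijGroup_eqI) auto
    ultimately show ?thesis by simp
  next
    case False
    then obtain x where x: "x \<in> S" by auto
    then obtain u where u: "u \<in> Q" and ux: "u x = z x"
      using transQ BijGroup_closed[OF z] by blast
    have "z = u"
    proof (rule BijGroup_eqI[OF z])
      show uc: "u \<in> carrier (BijGroup S)" using u Q by auto
      fix y assume "y \<in> S"
      then obtain t where t: "t \<in> P" and y: "y = t x" using transP x by blast
      have tc: "t \<in> carrier (BijGroup S)" using t P by auto
      show "z y = u y"
        using zP[OF t] comm[OF t u] x y ux z uc tc by (metis BijGroup_mult_apply)
    qed
    then show ?thesis using u by simp
  qed
next
  fix u assume "u \<in> Q"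
  then show "u \<in> centralizer (BijGroup S) P"
    using comm[symmetric] Q by (auto simp: centralizer_def)
qed

lemma simply_transitive_imp_transitive:
  assumes "simply_transitive_action G E \<phi>" "x \<in> E" "y \<in> E"
  shows "\<exists>g\<in>carrier G. \<phi> g x = y"
  using simply_transitive_action.unique_mover[OF assms] by blast

lemma simply_transitive_imp_free:
  assumes st: "simply_transitive_action G E \<phi>" and g: "g \<in> carrier G" and x: "x \<in> E" "\<phi> g x = x"
  shows "g = \<one>\<^bsub>G\<^esub>"
proof -
  interpret simply_transitive_action G E \<phi> by (rule st)
  interpret group_hom G "BijGroup E" \<phi> by (rule group_hom)
  have "\<phi> \<one>\<^bsub>G\<^esub> x = x" using x by (simp add: BijGroup_one_apply)
  then show ?thesis using unique_mover[OF x(1) x(1)] g x G.one_closed by blast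
qed

lemma simply_transitive_imp_faithful:
  assumes st: "simply_transitive_action G E \<phi>" and ne: "E \<noteq> {}"
  shows "faithful_action G E \<phi>"
proof -
  interpret simply_transitive_action G E \<phi> by (rule st)
  obtain x where x: "x \<in> E" using ne by auto
  have "inj_on \<phi> (carrier G)"
  proof (rule inj_onI)
    fix g h assume "g \<in> carrier G" "h \<in> carrier G" "\<phi> g = \<phi> h"
    then show "g = h"
      using unique_mover[OF x element_image[OF _ x refl, of g]] by metis
  qed
  then show ?thesis
    using group_action_axioms by (simp add: faithful_action_def faithful_action_axioms_def)
qed

lemma commuting_simply_transitive_imp_dual:
  assumes P: "subgroup P (BijGroup S)" and Q: "subgroup Q (BijGroup S)"
    and stP: "simply_transitive_action ((BijGroup S)\<lparr>carrier := P\<rparr>) S (\<lambda>t. t)"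
    and stQ: "simply_transitive_action ((BijGroup S)\<lparr>carrier := Q\<rparr>) S (\<lambda>t. t)"
    and comm: "\<And>t u. \<lbrakk>t \<in> P; u \<in> Q\<rbrakk> \<Longrightarrow> t \<otimes>\<^bsub>BijGroup S\<^esub> u = u \<otimes>\<^bsub>BijGroup S\<^esub> t"
  shows "lewin_dual S P Q"
proof -
  have tP: "\<exists>t\<in>P. t x = y" and tQ: "\<exists>t\<in>Q. t x = y" if "x \<in> S" "y \<in> S" for x y
    using simply_transitive_imp_transitive[OF stP that]
      simply_transitive_imp_transitive[OF stQ that] by simp_all
  have ne: "P \<noteq> {}" "Q \<noteq> {}"
    using subgroup.one_closed[OF P] subgroup.one_closed[OF Q] by auto
  have "centralizer (BijGroup S) P = Q" "centralizer (BijGroup S) Q = P"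
    using centralizer_of_transitive[of P S Q] centralizer_of_transitive[of Q S P]
      subgroup.subset[OF P] subgroup.subset[OF Q] tP tQ comm ne by metis+
  then show ?thesis
    unfolding lewin_dual_def using assms by blast
qed

text \<open>
  Centralizers are subgroups, so commutation passes from generators to the generated subgroup, first
  on one side and then on the other.
\<close>

lemma (in group) generate_commute:
  assumes A: "A \<subseteq> carrier G" and B: "B \<subseteq> carrier G"
    and comm: "\<And>a b. \<lbrakk>a \<in> A; b \<in> B\<rbrakk> \<Longrightarrow> a \<otimes> b = b \<otimes> a"
    and s: "s \<in> generate G A" and t: "t \<in> generate G B"
  shows "s \<otimes> t = t \<otimes> s"
proof -
  have sub: "subgroup (centralizer G C) G" if C: "C \<subseteq> carrier G" for C
  proof (rule subgroupI)
    fix a assume "a \<in> centralizer G C"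
    then have a: "a \<in> carrier G" "\<And>c. c \<in> C \<Longrightarrow> a \<otimes> c = c \<otimes> a" by (auto simp: centralizer_def)
    have "inv a \<otimes> c = c \<otimes> inv a" if "c \<in> C" for c
    proof -
      have c: "c \<in> carrier G" using that C by auto
      have "inv a \<otimes> c = inv a \<otimes> (c \<otimes> a) \<otimes> inv a" using a(1) c by (simp add: m_assoc)
      also have "\<dots> = inv a \<otimes> (a \<otimes> c) \<otimes> inv a" using a(2)[OF that] by simp
      also have "\<dots> = c \<otimes> inv a" using a(1) c by (simp flip: m_assoc)
      finally show ?thesis .
    qed
    then show "inv a \<in> centralizer G C" using a by (simp add: centralizer_def)
  next
    fix a b assume "a \<in> centralizer G C" "b \<in> centralizer G C"
    then have a: "a \<in> carrier G" "\<And>c. c \<in> C \<Longrightarrow> a \<otimes> c = c \<otimes> a"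
      and b: "b \<in> carrier G" "\<And>c. c \<in> C \<Longrightarrow> b \<otimes> c = c \<otimes> b" by (auto simp: centralizer_def)
    have "(a \<otimes> b) \<otimes> c = c \<otimes> (a \<otimes> b)" if "c \<in> C" for c
    proof -
      have c: "c \<in> carrier G" using that C by auto
      have "(a \<otimes> b) \<otimes> c = a \<otimes> (c \<otimes> b)" using a(1) b(1) b(2)[OF that] c by (simp add: m_assoc)
      also have "\<dots> = (c \<otimes> a) \<otimes> b" using a(1) b(1) a(2)[OF that] c by (simp flip: m_assoc)
      finally show ?thesis using a(1) b(1) c by (simp add: m_assoc)
    qed
    then show "a \<otimes> b \<in> centralizer G C" using a b by (simp add: centralizer_def)
  next
    have "\<one> \<in> centralizer G C" using C by (auto simp: centralizer_def)
    then show "centralizer G C \<noteq> {}" by auto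
  qed (auto simp: centralizer_def)
  have "B \<subseteq> centralizer G A" using B comm[symmetric] by (auto simp: centralizer_def)
  then have "generate G B \<subseteq> centralizer G A" by (rule generate_subgroup_incl[OF _ sub[OF A]])
  then have "A \<subseteq> centralizer G {t}" using A t by (fastforce simp: centralizer_def)
  then have "generate G A \<subseteq> centralizer G {t}"
    using generate_in_carrier[OF B t] by (intro generate_subgroup_incl sub) auto
  then show ?thesis using s by (auto simp: centralizer_def)
qed

section \<open>Maps glued from two pieces\<close>

lemma glue_left: "s \<in> S1 \<Longrightarrow> glue S1 S2 a b s = a s"
  by (simp add: glue_def)

lemma glue_right: "S1 \<inter> S2 = {} \<Longrightarrow> s \<in> S2 \<Longrightarrow> glue S1 S2 a b s = b s"
  by (auto simp: glue_def)

text \<open>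
  The targets may be permuted: \<open>T1 = S1\<close>, \<open>T2 = S2\<close> serves for sums of actions, and
  \<open>T1 = S2\<close>, \<open>T2 = S1\<close> for the exchanging involution.
\<close>

lemma glue_in_BijGroup:
  assumes disj: "S1 \<inter> S2 = {}" "T1 \<inter> T2 = {}" and un: "T1 \<union> T2 = S1 \<union> S2"
    and a: "bij_betw a S1 T1" and b: "bij_betw b S2 T2"
  shows "glue S1 S2 a b \<in> carrier (BijGroup (S1 \<union> S2))"
proof -
  have "bij_betw (glue S1 S2 a b) S1 T1" "bij_betw (glue S1 S2 a b) S2 T2"
    using a b bij_betw_cong[of S1 "glue S1 S2 a b" a] bij_betw_cong[of S2 "glue S1 S2 a b" b]
    by (simp_all add: glue_left glue_right[OF disj(1)])
  then have "bij_betw (glue S1 S2 a b) (S1 \<union> S2) (T1 \<union> T2)"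
    by (rule bij_betw_combine[OF _ _ disj(2)])
  then show ?thesis
    by (simp add: BijGroup_def Bij_def un glue_def)
qed

lemma sum_group_action:
  assumes 1: "group_action G S1 \<phi>1" and 2: "group_action G S2 \<phi>2" and disj: "S1 \<inter> S2 = {}"
  shows "group_action G (S1 \<union> S2) (sum_action S1 S2 \<phi>1 \<phi>2)"
proof -
  interpret A: group_action G S1 \<phi>1 by (rule 1)
  interpret B: group_action G S2 \<phi>2 by (rule 2)
  have G: "group G" by (rule group_hom.axioms(1)[OF A.group_hom])
  let ?\<phi> = "sum_action S1 S2 \<phi>1 \<phi>2"
  have bij: "?\<phi> g \<in> carrier (BijGroup (S1 \<union> S2))" if "g \<in> carrier G" for g
    unfolding sum_action_def
    by (rule glue_in_BijGroup[OF disj disj refl])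
      (use that A.inj_prop A.surj_prop B.inj_prop B.surj_prop in \<open>simp_all add: bij_betw_def\<close>)
  have "?\<phi> (g \<otimes>\<^bsub>G\<^esub> h) = ?\<phi> g \<otimes>\<^bsub>BijGroup (S1 \<union> S2)\<^esub> ?\<phi> h"
    if g: "g \<in> carrier G" and h: "h \<in> carrier G" for g h
  proof (rule BijGroup_eqI)
    show "?\<phi> (g \<otimes>\<^bsub>G\<^esub> h) \<in> carrier (BijGroup (S1 \<union> S2))"
      "?\<phi> g \<otimes>\<^bsub>BijGroup (S1 \<union> S2)\<^esub> ?\<phi> h \<in> carrier (BijGroup (S1 \<union> S2))"
      using bij[OF monoid.m_closed[OF group.is_monoid[OF G] g h]]
        monoid.m_closed[OF group.is_monoid[OF group_BijGroup] bij[OF g] bij[OF h]] by simp_all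
    fix s assume "s \<in> S1 \<union> S2"
    then consider "s \<in> S1" "\<phi>1 h s \<in> S1" | "s \<in> S2" "\<phi>2 h s \<in> S2"
      using A.element_image[OF h] B.element_image[OF h] by blast
    then show "?\<phi> (g \<otimes>\<^bsub>G\<^esub> h) s = (?\<phi> g \<otimes>\<^bsub>BijGroup (S1 \<union> S2)\<^esub> ?\<phi> h) s"
      using g h BijGroup_mult_apply[OF bij[OF g] bij[OF h] \<open>s \<in> S1 \<union> S2\<close>]
      by cases (simp_all add: sum_action_def glue_left
          glue_right[OF disj] A.composition_rule B.composition_rule)
  qed
  then show ?thesis
    using bij G group_BijGroup
    by (auto simp: group_action_def group_hom_def group_hom_axioms_def hom_def)
qed

lemma sum_faithful_action:
  assumes 1: "faithful_action G S1 \<phi>1" and 2: "group_action G S2 \<phi>2" and disj: "S1 \<inter> S2 = {}"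
  shows "faithful_action G (S1 \<union> S2) (sum_action S1 S2 \<phi>1 \<phi>2)"
proof -
  interpret A: faithful_action G S1 \<phi>1 by (rule 1)
  let ?\<phi> = "sum_action S1 S2 \<phi>1 \<phi>2"
  have "inj_on ?\<phi> (carrier G)"
  proof (rule inj_onI)
    fix g h assume g: "g \<in> carrier G" and h: "h \<in> carrier G" and eq: "?\<phi> g = ?\<phi> h"
    have "\<phi>1 g s = \<phi>1 h s" if "s \<in> S1" for s
      using fun_cong[OF eq, of s] that by (simp add: sum_action_def glue_left)
    then have "\<phi>1 g = \<phi>1 h"
      using A.bij_prop0 g h by (intro BijGroup_eqI[of _ S1]) (auto simp: BijGroup_def)
    then show "g = h" using A.faithful g h by (simp add: inj_on_eq_iff)
  qed
  then show ?thesis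
    using sum_group_action[OF A.group_action_axioms 2 disj]
    by (simp add: faithful_action_def faithful_action_axioms_def)
qed

section \<open>The involution that exchanges the two pieces\<close>

locale exchanged_pieces =
  fixes S1 S2 :: "'a set" and f :: "'a \<Rightarrow> 'a"
  assumes disj: "S1 \<inter> S2 = {}"
    and bij: "bij_betw f S1 S2"
begin

abbreviation "fbar \<equiv> bar_map S1 S2 f"

lemma f_in: "s \<in> S1 \<Longrightarrow> f s \<in> S2"
  using bij bij_betwE by blast

lemma piece_cases:
  assumes "s \<in> S1 \<union> S2"
  obtains "s \<in> S1" | r where "r \<in> S1" "s = f r"
  using assms bij unfolding bij_betw_def by blast

lemma fbar_left: "s \<in> S1 \<Longrightarrow> fbar s = f s"
  by (simp add: bar_map_def glue_left)

lemma fbar_right: "s \<in> S1 \<Longrightarrow> fbar (f s) = s"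
  using bij by (simp add: bar_map_def glue_right[OF disj] f_in bij_betw_inv_into_left)

lemma fbar_fbar: "s \<in> S1 \<union> S2 \<Longrightarrow> fbar (fbar s) = s"
  by (elim piece_cases) (simp_all add: fbar_left fbar_right)

lemma fbar_carrier: "fbar \<in> carrier (BijGroup (S1 \<union> S2))"
  unfolding bar_map_def
  using disj bij bij_betw_inv_into[OF bij] by (intro glue_in_BijGroup[of _ _ S2 S1]) auto

lemma fbar_involution: "fbar \<otimes>\<^bsub>BijGroup (S1 \<union> S2)\<^esub> fbar = \<one>\<^bsub>BijGroup (S1 \<union> S2)\<^esub>"
proof -
  interpret group "BijGroup (S1 \<union> S2)" by (rule group_BijGroup)
  show ?thesis
    by (rule BijGroup_eqI[of _ "S1 \<union> S2"])
      (simp_all add: fbar_carrier BijGroup_mult_apply BijGroup_one_apply fbar_fbar)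
qed

lemma fbar_exchanges: "fbar ` S1 = S2" "fbar ` S2 = S1"
proof -
  have "f ` S1 = S2" using bij by (simp add: bij_betw_def)
  then show "fbar ` S1 = S2" using fbar_left by simp
  have "fbar ` S2 = (\<lambda>s. fbar (f s)) ` S1"
    by (simp add: image_image flip: \<open>f ` S1 = S2\<close>)
  then show "fbar ` S2 = S1" by (simp add: fbar_right)
qed

lemma fbar_commutes_with_equivariant:
  assumes H1: "group_action H S1 \<psi>1" and H2: "group_action H S2 \<psi>2"
    and eq: "equivariant H S1 \<psi>1 \<psi>2 f" and h: "h \<in> carrier H"
  shows "fbar \<otimes>\<^bsub>BijGroup (S1 \<union> S2)\<^esub> sum_action S1 S2 \<psi>1 \<psi>2 h
    = sum_action S1 S2 \<psi>1 \<psi>2 h \<otimes>\<^bsub>BijGroup (S1 \<union> S2)\<^esub> fbar"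
proof -
  interpret group "BijGroup (S1 \<union> S2)" by (rule group_BijGroup)
  let ?t = "sum_action S1 S2 \<psi>1 \<psi>2 h"
  have t: "?t \<in> carrier (BijGroup (S1 \<union> S2))"
    using group_action.bij_prop0[OF sum_group_action[OF H1 H2 disj] h] by (simp add: BijGroup_def)
  have eq: "\<psi>2 h (f s) = f (\<psi>1 h s)" if "s \<in> S1" for s
    using eq h that by (simp add: equivariant_def)
  have in1: "\<psi>1 h s \<in> S1" if "s \<in> S1" for s
    using group_action.element_image[OF H1 h that refl] .
  show ?thesis
  proof (rule BijGroup_eqI)
    fix s assume s: "s \<in> S1 \<union> S2"
    then have "fbar (?t s) = ?t (fbar s)"
      by (elim piece_cases) (simp_all add: sum_action_def glue_left glue_right[OF disj]
          fbar_left fbar_right f_in in1 eq)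
    then show "(fbar \<otimes>\<^bsub>BijGroup (S1 \<union> S2)\<^esub> ?t) s = (?t \<otimes>\<^bsub>BijGroup (S1 \<union> S2)\<^esub> fbar) s"
      using t fbar_carrier s by (simp add: BijGroup_mult_apply)
  qed (use t fbar_carrier in simp_all)
qed

end

text \<open>
  The hypothesis is the wanted identity on \<open>S1\<close>. It carries over to \<open>S2\<close> because both maps are
  involutions that exchange the pieces.
\<close>

lemma bar_maps_commute:
  assumes f: "exchanged_pieces S1 S2 f" and k: "exchanged_pieces S1 S2 k"
    and kf: "\<And>s. s \<in> S1 \<Longrightarrow> inv_into S1 k (f s) = inv_into S1 f (k s)"
  shows "bar_map S1 S2 f \<otimes>\<^bsub>BijGroup (S1 \<union> S2)\<^esub> bar_map S1 S2 k
    = bar_map S1 S2 k \<otimes>\<^bsub>BijGroup (S1 \<union> S2)\<^esub> bar_map S1 S2 f"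
proof -
  interpret F: exchanged_pieces S1 S2 f by (rule f)
  interpret K: exchanged_pieces S1 S2 k by (rule k)
  interpret group "BijGroup (S1 \<union> S2)" by (rule group_BijGroup)
  have right: "F.fbar s = inv_into S1 f s" "K.fbar s = inv_into S1 k s" if "s \<in> S2" for s
    using that by (simp_all add: bar_map_def glue_right[OF F.disj])
  have left: "F.fbar (K.fbar s) = K.fbar (F.fbar s)" if "s \<in> S1" for s
    using that kf by (simp add: F.fbar_left K.fbar_left right F.f_in K.f_in)
  show ?thesis
  proof (rule BijGroup_eqI)
    fix s assume s: "s \<in> S1 \<union> S2"
    have "F.fbar (K.fbar s) = K.fbar (F.fbar s)"
    proof (cases "s \<in> S1")
      case False
      \<comment> \<open>The identity at \<open>kbar s \<in> S1\<close> reads \<open>fbar s = kbar (fbar (kbar s))\<close>; now apply \<open>kbar\<close>.\<close>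
      then have "s \<in> S2" using s by blast
      then have k: "K.fbar s \<in> S1" using K.fbar_exchanges by blast
      then have "F.fbar s = K.fbar (F.fbar (K.fbar s))"
        using left[OF k] K.fbar_fbar[OF s] by simp
      moreover have "F.fbar (K.fbar s) \<in> S1 \<union> S2" using k F.fbar_exchanges by blast
      ultimately show ?thesis using K.fbar_fbar by simp
    qed (rule left)
    then show "(F.fbar \<otimes>\<^bsub>BijGroup (S1 \<union> S2)\<^esub> K.fbar) s = (K.fbar \<otimes>\<^bsub>BijGroup (S1 \<union> S2)\<^esub> F.fbar) s"
      using F.fbar_carrier K.fbar_carrier s by (simp add: BijGroup_mult_apply)
  qed (use F.fbar_carrier K.fbar_carrier in simp_all)
qed

section \<open>Extending an action by an anti-equivariant exchange of the pieces\<close>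

locale anti_equivariant_pair = exchanged_pieces S1 S2 f
  for G :: "('g, 'm) monoid_scheme" (structure)
    and S1 S2 :: "'a set" and \<phi>1 \<phi>2 :: "'g \<Rightarrow> 'a \<Rightarrow> 'a" and f +
  assumes act1: "group_action G S1 \<phi>1"
    and act2: "group_action G S2 \<phi>2"
    and anti: "anti_equivariant G S1 \<phi>1 \<phi>2 f"
begin

abbreviation "Sym \<equiv> BijGroup (S1 \<union> S2)"
abbreviation "act \<equiv> sum_action S1 S2 \<phi>1 \<phi>2"
abbreviation "\<Gamma> \<equiv> act ` carrier G"
abbreviation "\<Gamma>bar \<equiv> generate Sym (\<Gamma> \<union> {fbar})"

lemma G: "group G"
  using group_hom.axioms(1)[OF group_action.group_hom[OF act1]] .

lemma inv_G: "g \<in> carrier G \<Longrightarrow> inv g \<in> carrier G"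
  by (rule group.inv_closed[OF G])

lemma act_hom: "group_hom G Sym act"
  using group_action.group_hom[OF sum_group_action[OF act1 act2 disj]] .

lemma act_carrier: "g \<in> carrier G \<Longrightarrow> act g \<in> carrier Sym"
  by (rule group_hom.hom_closed[OF act_hom])

lemma \<phi>1_in: "g \<in> carrier G \<Longrightarrow> s \<in> S1 \<Longrightarrow> \<phi>1 g s \<in> S1"
  using group_action.element_image[OF act1] by blast

lemma act_left: "s \<in> S1 \<Longrightarrow> act g s = \<phi>1 g s"
  by (simp add: sum_action_def glue_left)

lemma act_right: "s \<in> S2 \<Longrightarrow> act g s = \<phi>2 g s"
  by (simp add: sum_action_def glue_right[OF disj])

lemma \<phi>2_f: "g \<in> carrier G \<Longrightarrow> s \<in> S1 \<Longrightarrow> \<phi>2 g (f s) = f (\<phi>1 (inv g) s)"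
  using anti inv_G group.inv_inv[OF G] by (simp add: anti_equivariant_def)

lemma act_pieces: "g \<in> carrier G \<Longrightarrow> act g ` S1 = S1" "g \<in> carrier G \<Longrightarrow> act g ` S2 = S2"
  using group_action.surj_prop[OF act1] group_action.surj_prop[OF act2]
  by (simp_all add: act_left act_right)

lemma fbar_act:
  assumes "g \<in> carrier G" "s \<in> S1 \<union> S2"
  shows "fbar (act g s) = act (inv g) (fbar s)"
  using assms(2)
  by (rule piece_cases) (use assms(1) in \<open>simp_all add: fbar_left fbar_right f_in act_left act_right
      \<phi>2_f \<phi>1_in inv_G group.inv_inv[OF G]\<close>)

lemma fbar_anti_equivariant: "anti_equivariant G (S1 \<union> S2) act act fbar"
  using fbar_act by (simp add: anti_equivariant_def)

text \<open>
  This is anti-equivariance read as an identity of transformations. It forces \<open>\<Gamma>\<close> to be abelian,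
  since inversion is then the restriction of an automorphism.
\<close>

lemma conjugation_inverts:
  assumes "g \<in> carrier G"
  shows "fbar \<otimes>\<^bsub>Sym\<^esub> act g \<otimes>\<^bsub>Sym\<^esub> fbar = inv\<^bsub>Sym\<^esub> act g"
proof -
  interpret group Sym by (rule group_BijGroup)
  have "fbar \<otimes>\<^bsub>Sym\<^esub> act g \<otimes>\<^bsub>Sym\<^esub> fbar = act (inv g)"
  proof (rule BijGroup_eqI)
    fix s assume s: "s \<in> S1 \<union> S2"
    then show "(fbar \<otimes>\<^bsub>Sym\<^esub> act g \<otimes>\<^bsub>Sym\<^esub> fbar) s = act (inv g) s"
      using assms BijGroup_closed[OF fbar_carrier s]
      by (simp add: BijGroup_mult_apply fbar_carrier act_carrier fbar_act fbar_fbar)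
  qed (use assms in \<open>simp_all add: fbar_carrier act_carrier inv_G\<close>)
  then show ?thesis
    using group_hom.hom_inv[OF act_hom assms] by simp
qed

lemma subgroup_\<Gamma>: "subgroup \<Gamma> Sym"
  by (rule group_hom.img_is_subgroup[OF act_hom])

lemma normalizing: "normalizing_involution Sym \<Gamma> fbar"
proof -
  have "fbar \<otimes>\<^bsub>Sym\<^esub> t \<otimes>\<^bsub>Sym\<^esub> fbar \<in> \<Gamma>" if t: "t \<in> \<Gamma>" for t
  proof -
    obtain g where "g \<in> carrier G" "t = act g" using t by blast
    then show ?thesis using conjugation_inverts subgroup.m_inv_closed[OF subgroup_\<Gamma> t] by simp
  qed
  then show ?thesis
    by (intro normalizing_involution.intro normalizing_involution_axioms.intro group_BijGroup
        subgroup_\<Gamma> fbar_carrier fbar_involution)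
qed

lemma \<Gamma>bar_eq: "\<Gamma>bar = \<Gamma> \<union> (fbar <#\<^bsub>Sym\<^esub> \<Gamma>)"
  by (rule normalizing_involution.generate_union[OF normalizing])

lemma subgroup_\<Gamma>bar: "subgroup \<Gamma>bar Sym"
  unfolding \<Gamma>bar_eq by (rule normalizing_involution.subgroup_union[OF normalizing])

lemma \<Gamma>_preserves: "t \<in> \<Gamma> \<Longrightarrow> t ` S1 = S1 \<and> t ` S2 = S2"
  using act_pieces by blast

lemma coset_exchanges:
  assumes "t \<in> fbar <#\<^bsub>Sym\<^esub> \<Gamma>"
  shows "t ` S1 = S2 \<and> t ` S2 = S1"
proof -
  obtain g where g: "g \<in> carrier G" and t: "t = fbar \<otimes>\<^bsub>Sym\<^esub> act g"
    using assms by (auto simp: l_coset_def)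
  have "t s = fbar (act g s)" if "s \<in> S1 \<union> S2" for s
    using that g by (simp add: t BijGroup_mult_apply fbar_carrier act_carrier)
  then have "t ` S1 = fbar ` act g ` S1" "t ` S2 = fbar ` act g ` S2"
    by (simp_all add: image_image)
  then show ?thesis using act_pieces[OF g] fbar_exchanges by simp
qed

text \<open>
  Disjoint pieces coincide only if both are empty. This disposes of the one case in which a
  transformation can both preserve and exchange the pieces.
\<close>

lemma Sym_trivial:
  assumes "S1 = S2" "t \<in> carrier Sym" "u \<in> carrier Sym"
  shows "t = u"
  using assms disj by (intro BijGroup_eqI[OF assms(2,3)]) auto

lemma \<Gamma>bar_carrier: "t \<in> \<Gamma>bar \<Longrightarrow> t \<in> carrier Sym"
  using subgroup.subset[OF subgroup_\<Gamma>bar] by blast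

text \<open>
  \<open>\<Gamma>bar\<close> is the union of \<open>\<Gamma>\<close>, which preserves the pieces, and of a coset that exchanges them, so
  how an element treats the pieces tells in which part it lies.
\<close>

lemma \<Gamma>_eq_preserving: "\<Gamma> = {t \<in> \<Gamma>bar. t ` S1 = S1 \<and> t ` S2 = S2}"
proof (intro equalityI subsetI)
  fix t assume "t \<in> {t \<in> \<Gamma>bar. t ` S1 = S1 \<and> t ` S2 = S2}"
  then have t: "t \<in> \<Gamma>bar" "t ` S1 = S1" by auto
  show "t \<in> \<Gamma>"
  proof (rule ccontr)
    assume "t \<notin> \<Gamma>"
    then have "t \<in> fbar <#\<^bsub>Sym\<^esub> \<Gamma>" using t(1) unfolding \<Gamma>bar_eq by blast
    then have "S1 = S2" using t(2) coset_exchanges by simp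
    then have "t = \<one>\<^bsub>Sym\<^esub>"
      by (rule Sym_trivial[OF _ \<Gamma>bar_carrier[OF t(1)] \<Gamma>bar_carrier[OF generate.one]])
    then show False using \<open>t \<notin> \<Gamma>\<close> subgroup.one_closed[OF subgroup_\<Gamma>] by simp
  qed
qed (use \<Gamma>_preserves \<Gamma>bar_eq in blast)

lemma coset_eq_exchanging: "fbar <#\<^bsub>Sym\<^esub> \<Gamma> = {t \<in> \<Gamma>bar. t ` S1 = S2 \<and> t ` S2 = S1}"
proof (intro equalityI subsetI)
  fix t assume "t \<in> {t \<in> \<Gamma>bar. t ` S1 = S2 \<and> t ` S2 = S1}"
  then have t: "t \<in> \<Gamma>bar" "t ` S1 = S2" by auto
  show "t \<in> fbar <#\<^bsub>Sym\<^esub> \<Gamma>"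
  proof (rule ccontr)
    assume n: "t \<notin> fbar <#\<^bsub>Sym\<^esub> \<Gamma>"
    then have "t \<in> \<Gamma>" using t(1) unfolding \<Gamma>bar_eq by blast
    then have "S1 = S2" using t(2) \<Gamma>_preserves by simp
    then have "t = fbar"
      by (rule Sym_trivial[OF _ \<Gamma>bar_carrier[OF t(1)] fbar_carrier])
    then show False using n normalizing_involution.x_in_l_coset[OF normalizing] by simp
  qed
qed (use coset_exchanges \<Gamma>bar_eq in blast)

lemma \<Gamma>_coset_disjoint:
  assumes "S1 \<noteq> {}"
  shows "\<Gamma> \<inter> (fbar <#\<^bsub>Sym\<^esub> \<Gamma>) = {}"
proof (rule ccontr)
  assume "\<Gamma> \<inter> (fbar <#\<^bsub>Sym\<^esub> \<Gamma>) \<noteq> {}"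
  then obtain t where "t \<in> \<Gamma>" "t \<in> fbar <#\<^bsub>Sym\<^esub> \<Gamma>" by blast
  then have "S1 = S2"
    using \<Gamma>_preserves[of t] coset_exchanges[of t] by argo
  then show False using assms disj by simp
qed

lemma fbar_in_\<Gamma>:
  assumes "fbar \<in> \<Gamma>"
  shows "fbar = \<one>\<^bsub>Sym\<^esub>"
proof (rule Sym_trivial[OF _ fbar_carrier \<Gamma>bar_carrier[OF generate.one]])
  have "fbar ` S1 = S1" using \<Gamma>_preserves[OF assms] by (rule conjunct1)
  then show "S1 = S2" using fbar_exchanges(1) by (rule trans[OF sym])
qed

lemma semidirect: "internal_semidirect (Sym\<lparr>carrier := \<Gamma>bar\<rparr>) \<Gamma> (generate Sym {fbar})"
  unfolding \<Gamma>bar_eq normalizing_involution.generate_x[OF normalizing]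
  by (rule normalizing_involution.internal_semidirect_union[OF normalizing fbar_in_\<Gamma>])

text \<open>
  Through \<open>f\<close>, the element \<open>g\<close> moves \<open>f r\<close> to \<open>f q\<close> in \<open>S2\<close> exactly if its inverse moves \<open>r\<close> to
  \<open>q\<close> in \<open>S1\<close>.
\<close>

lemma simply_transitive_right:
  assumes st: "simply_transitive_action G S1 \<phi>1"
  shows "simply_transitive_action G S2 \<phi>2"
proof -
  interpret G: group G by (rule G)
  have "\<exists>!g. g \<in> carrier G \<and> \<phi>2 g x = y" if xy: "x \<in> S2" "y \<in> S2" for x y
  proof -
    obtain r q where r: "r \<in> S1" "x = f r" and q: "q \<in> S1" "y = f q"
      using xy bij_betw_imp_surj_on[OF bij] by blast
    have eq: "\<phi>2 g x = y \<longleftrightarrow> \<phi>1 (inv g) r = q" if "g \<in> carrier G" for g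
      using that r q \<phi>2_f \<phi>1_in[OF inv_G] bij_betw_imp_inj_on[OF bij] by (metis inj_on_eq_iff)
    obtain g where g: "g \<in> carrier G" "\<phi>1 g r = q"
      and uniq: "\<And>h. h \<in> carrier G \<Longrightarrow> \<phi>1 h r = q \<Longrightarrow> h = g"
      using simply_transitive_action.unique_mover[OF st r(1) q(1)] by blast
    show ?thesis
    proof (rule ex1I[of _ "inv g"])
      show "inv g \<in> carrier G \<and> \<phi>2 (inv g) x = y" using g eq by simp
      fix h assume h: "h \<in> carrier G \<and> \<phi>2 h x = y"
      then have "inv h = g" using uniq[of "inv h"] eq[of h] by simp
      then show "h = inv g" using h by auto
    qed
  qed
  then show ?thesis
    using act2 by (simp add: simply_transitive_action_def simply_transitive_action_axioms_def)
qed

text \<open>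
  Points of one piece are joined by \<open>\<Gamma>\<close>, points of different pieces by the coset of \<open>fbar\<close>. A
  transformation with a fixed point cannot exchange the disjoint pieces, so it lies in \<open>\<Gamma>\<close>,
  which acts freely on each piece.
\<close>

lemma simply_transitive_extension:
  assumes st1: "simply_transitive_action G S1 \<phi>1"
  shows "simply_transitive_action (Sym\<lparr>carrier := \<Gamma>bar\<rparr>) (S1 \<union> S2) (\<lambda>t. t)"
proof (rule simply_transitive_subgroupI[OF subgroup_\<Gamma>bar])
  note st2 = simply_transitive_right[OF st1]
  have same: "\<exists>t\<in>\<Gamma>. t x = y" if "x \<in> S1 \<and> y \<in> S1 \<or> x \<in> S2 \<and> y \<in> S2" for x y
    using that simply_transitive_imp_transitive[OF st1, of x y]
      simply_transitive_imp_transitive[OF st2, of x y] by (auto simp: act_left act_right)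
  fix x y assume x: "x \<in> S1 \<union> S2" and y: "y \<in> S1 \<union> S2"
  show "\<exists>t\<in>\<Gamma>bar. t x = y"
  proof (cases "x \<in> S1 \<and> y \<in> S1 \<or> x \<in> S2 \<and> y \<in> S2")
    case True
    then show ?thesis using same \<Gamma>bar_eq by blast
  next
    \<comment> \<open>If \<open>x\<close> and \<open>y\<close> lie in different pieces, then \<open>x\<close> and \<open>fbar y\<close> lie in the same one.\<close>
    case False
    then have "x \<in> S1 \<and> fbar y \<in> S1 \<or> x \<in> S2 \<and> fbar y \<in> S2"
      using x y fbar_exchanges by blast
    then obtain t where t: "t \<in> \<Gamma>" "t x = fbar y" using same by blast
    have "t \<in> carrier Sym" using t(1) act_carrier by auto
    then have "(fbar \<otimes>\<^bsub>Sym\<^esub> t) x = y"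
      using t(2) x y by (simp add: BijGroup_mult_apply fbar_carrier fbar_fbar)
    moreover have "fbar \<otimes>\<^bsub>Sym\<^esub> t \<in> \<Gamma>bar"
      using t(1) unfolding \<Gamma>bar_eq l_coset_def by blast
    ultimately show ?thesis by blast
  qed
next
  note st2 = simply_transitive_right[OF st1]
  fix t x assume t: "t \<in> \<Gamma>bar" and x: "x \<in> S1 \<union> S2" and fix_x: "t x = x"
  have "\<not> (t ` S1 = S2 \<and> t ` S2 = S1)"
  proof
    assume exch: "t ` S1 = S2 \<and> t ` S2 = S1"
    have "x \<in> S1 \<Longrightarrow> x \<in> S2" "x \<in> S2 \<Longrightarrow> x \<in> S1"
      using imageI[of x S1 t] imageI[of x S2 t] by (simp_all only: exch fix_x)
    then show False using x disj by blast
  qed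
  then obtain g where g: "g \<in> carrier G" and tg: "t = act g"
    using t coset_exchanges \<Gamma>bar_eq by blast
  have "g = \<one>"
    using x
  proof
    assume "x \<in> S1"
    then show ?thesis using simply_transitive_imp_free[OF st1 g] fix_x tg by (simp add: act_left)
  next
    assume "x \<in> S2"
    then show ?thesis using simply_transitive_imp_free[OF st2 g] fix_x tg by (simp add: act_right)
  qed
  then show "t = \<one>\<^bsub>Sym\<^esub>" using group_hom.hom_one[OF act_hom] tg by simp
qed

end

section \<open>Two commuting extensions\<close>

locale commuting_pairs =
  F: anti_equivariant_pair G S1 S2 \<phi>1 \<phi>2 f + K: anti_equivariant_pair H S1 S2 \<psi>1 \<psi>2 k
  for G :: "('g, 'm) monoid_scheme" and H :: "('h, 'n) monoid_scheme" and S1 S2 :: "'a set"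
    and \<phi>1 \<phi>2 \<psi>1 \<psi>2 f k +
  assumes kf: "s \<in> S1 \<Longrightarrow> inv_into S1 k (f s) = inv_into S1 f (k s)"
    and comm1: "actions_commute G H S1 \<phi>1 \<psi>1"
    and f_equi: "equivariant H S1 \<psi>1 \<psi>2 f"
    and k_equi: "equivariant G S1 \<phi>1 \<phi>2 k"
begin

text \<open>
  A point \<open>f r\<close> of \<open>S2\<close> is moved by \<open>g\<close> as \<open>f\<close> of the inverse of \<open>g\<close> applied to \<open>r\<close>, and by
  \<open>h\<close> as \<open>f\<close> of \<open>h\<close> applied to \<open>r\<close>; both operations commute on \<open>S1\<close>.
\<close>

lemma comm2: "actions_commute G H S2 \<phi>2 \<psi>2"
  unfolding actions_commute_def
proof (intro ballI)
  fix g h s assume g: "g \<in> carrier G" and h: "h \<in> carrier H" and "s \<in> S2"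
  then obtain r where r: "r \<in> S1" "s = f r"
    using F.bij unfolding bij_betw_def by blast
  have f: "\<psi>2 h (f q) = f (\<psi>1 h q)" if "q \<in> S1" for q
    using f_equi h that by (simp add: equivariant_def)
  have c: "\<phi>1 (inv\<^bsub>G\<^esub> g) (\<psi>1 h r) = \<psi>1 h (\<phi>1 (inv\<^bsub>G\<^esub> g) r)"
    using comm1 F.inv_G[OF g] h r by (simp add: actions_commute_def)
  show "\<phi>2 g (\<psi>2 h s) = \<psi>2 h (\<phi>2 g s)"
    using g h r(1) by (simp add: r(2) f F.\<phi>2_f F.\<phi>1_in F.inv_G K.\<phi>1_in c)
qed

lemma acts_commute:
  assumes g: "g \<in> carrier G" and h: "h \<in> carrier H"
  shows "F.act g \<otimes>\<^bsub>F.Sym\<^esub> K.act h = K.act h \<otimes>\<^bsub>F.Sym\<^esub> F.act g"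
proof -
  interpret group F.Sym by (rule group_BijGroup)
  have in2: "\<phi>2 g s \<in> S2" "\<psi>2 h s \<in> S2" if "s \<in> S2" for s
    using that group_action.element_image[OF F.act2 g] group_action.element_image[OF K.act2 h]
    by blast+
  show ?thesis
  proof (rule BijGroup_eqI)
    fix s assume s: "s \<in> S1 \<union> S2"
    then have "F.act g (K.act h s) = K.act h (F.act g s)"
      using g h comm1 comm2 in2
      by (auto simp: actions_commute_def F.act_left F.act_right K.act_left K.act_right
          F.\<phi>1_in K.\<phi>1_in)
    then show "(F.act g \<otimes>\<^bsub>F.Sym\<^esub> K.act h) s = (K.act h \<otimes>\<^bsub>F.Sym\<^esub> F.act g) s"
      using s g h by (simp add: BijGroup_mult_apply F.act_carrier K.act_carrier)
  qed (use g h in \<open>simp_all add: F.act_carrier K.act_carrier\<close>)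
qed

lemma fbar_kbar: "F.fbar \<otimes>\<^bsub>F.Sym\<^esub> K.fbar = K.fbar \<otimes>\<^bsub>F.Sym\<^esub> F.fbar"
  by (rule bar_maps_commute[OF F.exchanged_pieces_axioms K.exchanged_pieces_axioms kf])

text \<open>
  Each of the four pairs of generators commutes: the two actions by assumption, the two involutions
  by \<open>fbar_kbar\<close>, and an involution with the other action because its map is equivariant.
\<close>

lemma extensions_commute:
  assumes "t \<in> F.\<Gamma>bar" "u \<in> K.\<Gamma>bar"
  shows "t \<otimes>\<^bsub>F.Sym\<^esub> u = u \<otimes>\<^bsub>F.Sym\<^esub> t"
proof -
  interpret group F.Sym by (rule group_BijGroup)
  show ?thesis
  proof (rule generate_commute[OF _ _ _ assms])
    fix a b assume "a \<in> F.\<Gamma> \<union> {F.fbar}" and "b \<in> K.\<Gamma> \<union> {K.fbar}"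
    then show "a \<otimes>\<^bsub>F.Sym\<^esub> b = b \<otimes>\<^bsub>F.Sym\<^esub> a"
      using acts_commute fbar_kbar
        F.fbar_commutes_with_equivariant[OF K.act1 K.act2 f_equi]
        K.fbar_commutes_with_equivariant[OF F.act1 F.act2 k_equi, symmetric] by auto
  qed (auto simp: F.fbar_carrier K.fbar_carrier F.act_carrier K.act_carrier)
qed

lemma dual:
  assumes "simply_transitive_action G S1 \<phi>1" "simply_transitive_action H S1 \<psi>1"
  shows "lewin_dual (S1 \<union> S2) F.\<Gamma>bar K.\<Gamma>bar"
  using F.subgroup_\<Gamma>bar K.subgroup_\<Gamma>bar F.simply_transitive_extension[OF assms(1)]
    K.simply_transitive_extension[OF assms(2)] extensions_commute
  by (rule commuting_simply_transitive_imp_dual)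

end

section \<open>Semidirect structure and duality of the extensions\<close>

theorem theorem4p1:
  fixes G :: "('g, 'm) monoid_scheme"
    and S1 S2 Sbar :: "'a set"
    and \<phi>1 \<phi>2 \<phi>bar :: "'g \<Rightarrow> 'a \<Rightarrow> 'a"
    and f fbar :: "'a \<Rightarrow> 'a"
    and Sym :: "('a \<Rightarrow> 'a) monoid"
    and GS Gbar F :: "('a \<Rightarrow> 'a) set"
  assumes act1: "faithful_action G S1 \<phi>1"
    and act2: "faithful_action G S2 \<phi>2"
    and disj: "S1 \<inter> S2 = {}"
    and bij: "bij_betw f S1 S2"
    and anti: "anti_equivariant G S1 \<phi>1 \<phi>2 f"
    and Sbar: "Sbar = S1 \<union> S2"
    and Sym: "Sym = BijGroup Sbar"
    and fbar: "fbar = bar_map S1 S2 f"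
    and \<phi>bar: "\<phi>bar = sum_action S1 S2 \<phi>1 \<phi>2"
    and GS: "GS = \<phi>bar ` carrier G"
    and Gbar: "Gbar = generate Sym (GS \<union> {fbar})"
    and F: "F = generate Sym {fbar}"
  shows
    \<comment> \<open>the setup: \<open>G\<close> embeds into the symmetric group\<close>
    "(faithful_action G Sbar \<phi>bar \<and> subgroup GS Sym)
    \<and>
    \<comment> \<open>(1)\<close>
    (anti_equivariant G Sbar \<phi>bar \<phi>bar fbar \<and>
     fbar \<in> carrier Sym \<and> fbar \<otimes>\<^bsub>Sym\<^esub> fbar = \<one>\<^bsub>Sym\<^esub> \<and> (S1 \<noteq> {} \<longrightarrow> fbar \<noteq> \<one>\<^bsub>Sym\<^esub>))
    \<and>
    \<comment> \<open>(2)\<close>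
    (GS \<lhd> Sym\<lparr>carrier := Gbar\<rparr> \<and>
     internal_semidirect (Sym\<lparr>carrier := Gbar\<rparr>) GS F \<and>
     (\<forall>g\<in>GS. fbar \<otimes>\<^bsub>Sym\<^esub> g \<otimes>\<^bsub>Sym\<^esub> inv\<^bsub>Sym\<^esub> fbar = inv\<^bsub>Sym\<^esub> g) \<and>
     Gbar = GS \<union> (fbar <#\<^bsub>Sym\<^esub> GS) \<and>
     Gbar = GS \<union> (GS #>\<^bsub>Sym\<^esub> fbar) \<and>
     fbar <#\<^bsub>Sym\<^esub> GS = GS #>\<^bsub>Sym\<^esub> fbar \<and>
     (S1 \<noteq> {} \<longrightarrow> GS \<inter> (fbar <#\<^bsub>Sym\<^esub> GS) = {}) \<and>
     GS = {t \<in> Gbar. t ` S1 = S1 \<and> t ` S2 = S2} \<and>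
     fbar <#\<^bsub>Sym\<^esub> GS = {t \<in> Gbar. t ` S1 = S2 \<and> t ` S2 = S1})
    \<and>
    \<comment> \<open>(3); the lists of \<open>exact_seq\<close> start at the right end of the sequence\<close>
    (\<exists>p. (\<forall>g\<in>GS. \<forall>i::int. p (g \<otimes>\<^bsub>Sym\<^esub> fbar [^]\<^bsub>Sym\<^esub> i) = fbar [^]\<^bsub>Sym\<^esub> i) \<and>
       exact_seq
         ([Sym\<lparr>carrier := {\<one>\<^bsub>Sym\<^esub>}\<rparr>, Sym\<lparr>carrier := F\<rparr>, Sym\<lparr>carrier := Gbar\<rparr>,
           Sym\<lparr>carrier := GS\<rparr>, Sym\<lparr>carrier := {\<one>\<^bsub>Sym\<^esub>}\<rparr>],
          [\<lambda>t. \<one>\<^bsub>Sym\<^esub>, p, \<lambda>t. t, \<lambda>t. t]) \<and>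
       right_split (Sym\<lparr>carrier := Gbar\<rparr>) (Sym\<lparr>carrier := F\<rparr>) p \<and>
       sequences_isomorphic
         (Sym\<lparr>carrier := GS\<rparr>) (Sym\<lparr>carrier := Gbar\<rparr>) (Sym\<lparr>carrier := F\<rparr>) (\<lambda>t. t) p
         (Sym\<lparr>carrier := GS\<rparr>)
         (semidirect_product (Sym\<lparr>carrier := GS\<rparr>) (Sym\<lparr>carrier := F\<rparr>)
            (\<lambda>q g. q \<otimes>\<^bsub>Sym\<^esub> g \<otimes>\<^bsub>Sym\<^esub> inv\<^bsub>Sym\<^esub> q))
         (Sym\<lparr>carrier := F\<rparr>) (\<lambda>g. (g, \<one>\<^bsub>Sym\<^esub>)) snd)
    \<and>
    \<comment> \<open>(4)\<close>
    (simply_transitive_action G S1 \<phi>1 \<longrightarrow>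
       simply_transitive_action G S2 \<phi>2 \<and>
       simply_transitive_action (Sym\<lparr>carrier := Gbar\<rparr>) Sbar (\<lambda>t. t))
    \<and>
    \<comment> \<open>(5)\<close>
    (simply_transitive_action G S1 \<phi>1 \<longrightarrow>
      (\<forall>(H :: ('h, 'n) monoid_scheme) \<psi>1 \<psi>2 k kbar HS Hbar.
         group_action H S1 \<psi>1 \<and> group_action H S2 \<psi>2 \<and>
         bij_betw k S1 S2 \<and> anti_equivariant H S1 \<psi>1 \<psi>2 k \<and>
         kbar = bar_map S1 S2 k \<and>
         simply_transitive_action H S1 \<psi>1 \<and>
         HS = sum_action S1 S2 \<psi>1 \<psi>2 ` carrier H \<and>
         Hbar = generate Sym (HS \<union> {kbar}) \<and>
         (\<forall>s\<in>S1. inv_into S1 k (f s) = inv_into S1 f (k s)) \<and>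
         actions_commute G H S1 \<phi>1 \<psi>1 \<and>
         equivariant H S1 \<psi>1 \<psi>2 f \<and>
         equivariant G S1 \<phi>1 \<phi>2 k
         \<longrightarrow>
         (S1 \<noteq> {} \<longrightarrow> faithful_action H S1 \<psi>1 \<and> faithful_action H S2 \<psi>2 \<and>
                     faithful_action H Sbar (sum_action S1 S2 \<psi>1 \<psi>2)) \<and>
         actions_commute G H S2 \<phi>2 \<psi>2 \<and>
         fbar \<otimes>\<^bsub>Sym\<^esub> kbar = kbar \<otimes>\<^bsub>Sym\<^esub> fbar \<and>
         lewin_dual Sbar Gbar Hbar))"
proof -
  have 1: "group_action G S1 \<phi>1" and 2: "group_action G S2 \<phi>2"
    using act1 act2 by (simp_all add: faithful_action_def)
  interpret E: anti_equivariant_pair G S1 S2 \<phi>1 \<phi>2 f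
    by (intro anti_equivariant_pair.intro exchanged_pieces.intro anti_equivariant_pair_axioms.intro
        disj bij 1 2 anti)
  interpret N: normalizing_involution E.Sym E.\<Gamma> E.fbar by (rule E.normalizing)
  note eqs = F Gbar GS \<phi>bar fbar Sym Sbar
  have embedding: "faithful_action G Sbar \<phi>bar \<and> subgroup GS Sym"
    unfolding eqs using sum_faithful_action[OF act1 2 disj] E.subgroup_\<Gamma> by blast
  have fbar_nontrivial: "fbar \<noteq> \<one>\<^bsub>Sym\<^esub>" if ne: "S1 \<noteq> {}"
    unfolding eqs
  proof
    assume eq: "E.fbar = \<one>\<^bsub>E.Sym\<^esub>"
    obtain s where s: "s \<in> S1" using ne by blast
    then have "f s = s" using E.fbar_left[OF s] by (simp add: eq BijGroup_one_apply)
    then show False using E.f_in[OF s] s disj by auto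
  qed
  have involution: "anti_equivariant G Sbar \<phi>bar \<phi>bar fbar \<and>
     fbar \<in> carrier Sym \<and> fbar \<otimes>\<^bsub>Sym\<^esub> fbar = \<one>\<^bsub>Sym\<^esub> \<and> (S1 \<noteq> {} \<longrightarrow> fbar \<noteq> \<one>\<^bsub>Sym\<^esub>)"
    using fbar_nontrivial E.fbar_anti_equivariant E.fbar_carrier E.fbar_involution
    unfolding eqs by blast
  have conj: "\<forall>g\<in>GS. fbar \<otimes>\<^bsub>Sym\<^esub> g \<otimes>\<^bsub>Sym\<^esub> inv\<^bsub>Sym\<^esub> fbar = inv\<^bsub>Sym\<^esub> g"
    unfolding eqs using E.conjugation_inverts N.inv_x by auto
  have semidirect:
    "GS \<lhd> Sym\<lparr>carrier := Gbar\<rparr>"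
    "internal_semidirect (Sym\<lparr>carrier := Gbar\<rparr>) GS F"
    "Gbar = GS \<union> (fbar <#\<^bsub>Sym\<^esub> GS)"
    "Gbar = GS \<union> (GS #>\<^bsub>Sym\<^esub> fbar)"
    "fbar <#\<^bsub>Sym\<^esub> GS = GS #>\<^bsub>Sym\<^esub> fbar"
    "S1 \<noteq> {} \<longrightarrow> GS \<inter> (fbar <#\<^bsub>Sym\<^esub> GS) = {}"
    "GS = {t \<in> Gbar. t ` S1 = S1 \<and> t ` S2 = S2}"
    "fbar <#\<^bsub>Sym\<^esub> GS = {t \<in> Gbar. t ` S1 = S2 \<and> t ` S2 = S1}"
    unfolding eqs
    by (rule N.normal_union[folded N.generate_union], rule E.semidirect, rule N.generate_union,
        rule N.generate_union[unfolded N.l_coset_x_eq], rule N.l_coset_x_eq,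
        rule impI, erule E.\<Gamma>_coset_disjoint, rule E.\<Gamma>_eq_preserving,
        rule E.coset_eq_exchanging)
  obtain p where p:
    "\<And>n q. \<lbrakk>n \<in> GS; q \<in> F\<rbrakk> \<Longrightarrow> p (n \<otimes>\<^bsub>Sym\<^esub> q) = q"
    "exact_seq
         ([Sym\<lparr>carrier := {\<one>\<^bsub>Sym\<^esub>}\<rparr>, Sym\<lparr>carrier := F\<rparr>, Sym\<lparr>carrier := Gbar\<rparr>,
           Sym\<lparr>carrier := GS\<rparr>, Sym\<lparr>carrier := {\<one>\<^bsub>Sym\<^esub>}\<rparr>],
          [\<lambda>t. \<one>\<^bsub>Sym\<^esub>, p, \<lambda>t. t, \<lambda>t. t])"
    "right_split (Sym\<lparr>carrier := Gbar\<rparr>) (Sym\<lparr>carrier := F\<rparr>) p"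
    "sequences_isomorphic
         (Sym\<lparr>carrier := GS\<rparr>) (Sym\<lparr>carrier := Gbar\<rparr>) (Sym\<lparr>carrier := F\<rparr>) (\<lambda>t. t) p
         (Sym\<lparr>carrier := GS\<rparr>)
         (semidirect_product (Sym\<lparr>carrier := GS\<rparr>) (Sym\<lparr>carrier := F\<rparr>)
            (\<lambda>q g. q \<otimes>\<^bsub>Sym\<^esub> g \<otimes>\<^bsub>Sym\<^esub> inv\<^bsub>Sym\<^esub> q))
         (Sym\<lparr>carrier := F\<rparr>) (\<lambda>g. (g, \<one>\<^bsub>Sym\<^esub>)) snd"
    using internal_semidirect_split[OF group_BijGroup E.subgroup_\<Gamma>bar E.semidirect]
    unfolding eqs by blast
  have "p (g \<otimes>\<^bsub>Sym\<^esub> fbar [^]\<^bsub>Sym\<^esub> i) = fbar [^]\<^bsub>Sym\<^esub> i" if "g \<in> GS" for g and i :: int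
  proof (rule p(1)[OF that])
    show "fbar [^]\<^bsub>Sym\<^esub> i \<in> F"
      unfolding eqs N.generate_x by (rule N.x_pow)
  qed
  note sequence = this p(2-4)
  have transitive: "simply_transitive_action G S2 \<phi>2 \<and>
       simply_transitive_action (Sym\<lparr>carrier := Gbar\<rparr>) Sbar (\<lambda>t. t)"
    if "simply_transitive_action G S1 \<phi>1"
    unfolding eqs using E.simply_transitive_right[OF that] E.simply_transitive_extension[OF that] ..
  have duality:
    "(S1 \<noteq> {} \<longrightarrow> faithful_action H S1 \<psi>1 \<and> faithful_action H S2 \<psi>2 \<and>
       faithful_action H Sbar (sum_action S1 S2 \<psi>1 \<psi>2)) \<and>
     actions_commute G H S2 \<phi>2 \<psi>2 \<and>
     fbar \<otimes>\<^bsub>Sym\<^esub> kbar = kbar \<otimes>\<^bsub>Sym\<^esub> fbar \<and>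
     lewin_dual Sbar Gbar Hbar"
    if st: "simply_transitive_action G S1 \<phi>1"
      and H: "group_action H S1 \<psi>1 \<and> group_action H S2 \<psi>2 \<and>
         bij_betw k S1 S2 \<and> anti_equivariant H S1 \<psi>1 \<psi>2 k \<and>
         kbar = bar_map S1 S2 k \<and>
         simply_transitive_action H S1 \<psi>1 \<and>
         HS = sum_action S1 S2 \<psi>1 \<psi>2 ` carrier H \<and>
         Hbar = generate Sym (HS \<union> {kbar}) \<and>
         (\<forall>s\<in>S1. inv_into S1 k (f s) = inv_into S1 f (k s)) \<and>
         actions_commute G H S1 \<phi>1 \<psi>1 \<and>
         equivariant H S1 \<psi>1 \<psi>2 f \<and>
         equivariant G S1 \<phi>1 \<phi>2 k"
    for H :: "('h, 'n) monoid_scheme" and \<psi>1 \<psi>2 k kbar HS Hbar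
  proof -
    have kbar: "kbar = bar_map S1 S2 k" and HS: "HS = sum_action S1 S2 \<psi>1 \<psi>2 ` carrier H"
      and Hbar: "Hbar = generate Sym (HS \<union> {kbar})"
      and stH: "simply_transitive_action H S1 \<psi>1"
      using H by simp_all
    interpret C: commuting_pairs G H S1 S2 \<phi>1 \<phi>2 \<psi>1 \<psi>2 f k
      by (intro commuting_pairs.intro commuting_pairs_axioms.intro E.anti_equivariant_pair_axioms
          anti_equivariant_pair.intro exchanged_pieces.intro anti_equivariant_pair_axioms.intro disj)
        (use H in simp_all)
    have "faithful_action H S1 \<psi>1" "faithful_action H S2 \<psi>2"
      "faithful_action H (S1 \<union> S2) (sum_action S1 S2 \<psi>1 \<psi>2)" if ne: "S1 \<noteq> {}"
    proof -
      show faithful: "faithful_action H S1 \<psi>1" by (rule simply_transitive_imp_faithful[OF stH ne])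
      have "S2 \<noteq> {}" using ne C.K.f_in by blast
      then show "faithful_action H S2 \<psi>2"
        by (rule simply_transitive_imp_faithful[OF C.K.simply_transitive_right[OF stH]])
      show "faithful_action H (S1 \<union> S2) (sum_action S1 S2 \<psi>1 \<psi>2)"
        by (rule sum_faithful_action[OF faithful C.K.act2 disj])
    qed
    then show ?thesis
      unfolding Hbar HS kbar eqs using C.comm2 C.fbar_kbar C.dual[OF st stH] by blast
  qed
  show ?thesis
    by (rule conjI[OF embedding conjI[OF involution conjI[OF _ conjI[OF _ conjI]]]])
      ((intro conjI; fact conj semidirect), (rule exI[of _ p], intro conjI ballI allI; fact sequence),
        (rule impI, erule transitive), (intro impI allI, rule duality))
qed

end
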